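(* Let $(X,d)$ be a Polish metric space and let $a,b>0$. For any $\mu_1,\mu_2\in\mathcal{M}(X)$, $$W_1^{a,b}(\mu_1,\mu_2)=\sup_{(\varphi_1,\varphi_2)\in\Phi_W}\ \sum_{i=1}^{2}\int_X I(\varphi_i(x))\,d\mu_i(x),$$ where $I(\varphi)=\inf_{s\ge 0}\left(s\varphi+a|1-s|\right)$ for $\varphi\in\mathbb{R}$, and $$\Phi_W=\{(\varphi_1,\varphi_2)\in C_b(X)\times C_b(X)\;:\;\varphi_1(x)+\varphi_2(y)\le b\,d(x,y)\text{ and }\varphi_1(x),\varphi_2(y)\ge -a\ \text{ for all }x,y\in X\}.$$
   Context: A Polish metric space is a complete separable metric space. $C_b(X)$ is the space of bounded continuous real functions on $X$. $\mathcal{M}(X)$ is the set of nonnegative Borel measures on $X$ with finite mass; $\mathcal{M}_p(X)$ ($p\ge1$) is the set of $\mu\in\mathcal{M}(X)$ with $\int_X d(x,x_0)^p\,d\mu(x)<\infty$ for some (equivalently any) $x_0\in X$. For $\mu\in\mathcal{M}(X)$, $|\mu|:=\mu(X)$, and for a difference of two such measures, $|\mu-\nu|$ denotes the total variation mass of the signed measure $\mu-\nu$. Wasserstein distance: for $\mu,\nu\in\mathcal{M}(X)$ with $|\mu|=|\nu|$, $\Pi(\mu,\nu)$ is the set of Borel probability measures $\pi$ on $X\times X$ with $|\mu|\pi(A\times X)=\mu(A)$ and $|\nu|\pi(X\times B)=\nu(B)$ for all Borel $A,B\subset X$; for $\mu,\nu\in\mathcal{M}_p(X)$ with $|\mu|=|\nu|$,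 $W_p(\mu,\nu):=\left(|\mu|\inf_{\pi\in\Pi(\mu,\nu)}\int_{X\times X}d(x,y)^p\,d\pi(x,y)\right)^{1/p}$. Generalized Wasserstein distance: for $a,b>0$, $p\ge1$ and $\mu,\nu\in\mathcal{M}(X)$, $$W_p^{a,b}(\mu,\nu):=\inf\{a|\mu-\widetilde\mu|+a|\nu-\widetilde\nu|+b\,W_p(\widetilde\mu,\widetilde\nu)\;:\;\widetilde\mu,\widetilde\nu\in\mathcal{M}_p(X),\ |\widetilde\mu|=|\widetilde\nu|\}.$$ *)

theory Defs
  imports "HOL-Probability.Probability"
begin

text \<open>A Polish metric space is a type of class \<open>polish_space\<close>; finite Borel measures on it are
  elements of \<open>'a measure\<close> with the Borel sigma-algebra.\<close>

definition finite_borel_measures :: "'a::topological_space measure set" where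
  "finite_borel_measures = {\<mu>. sets \<mu> = sets borel \<and> finite_measure \<mu>}"

definition finite_borel_measures_moment :: "real \<Rightarrow> 'a::metric_space measure set" where
  "finite_borel_measures_moment p =
     {\<mu> \<in> finite_borel_measures. \<exists>x0. (\<integral>\<^sup>+x. ennreal (dist x x0 powr p) \<partial>\<mu>) < \<infinity>}"

definition mass :: "'a measure \<Rightarrow> real" where
  "mass \<mu> = measure \<mu> (space \<mu>)"

text \<open>Total variation mass of the signed measure \<open>\<mu> - \<nu>\<close>, as the supremum over finite measurable
  partitions of the space (no factor one half).  For finite measures the supremum is over a
  nonempty set of reals bounded by \<open>mass \<mu> + mass \<nu>\<close>.\<close>

definition tv_mass_diff :: "'a::topological_space measure \<Rightarrow> 'a measure \<Rightarrow> real" where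
  "tv_mass_diff \<mu> \<nu> =
     (SUP P \<in> {P. finite P \<and> disjoint P \<and> P \<subseteq> sets borel \<and> \<Union>P = UNIV}.
        \<Sum>A\<in>P. \<bar>measure \<mu> A - measure \<nu> A\<bar>)"

text \<open>The plans are probability measures also when the common mass of \<open>\<mu>\<close> and \<open>\<nu>\<close> is not one;
  this is why the marginal conditions carry the factors \<open>mass \<mu>\<close> and \<open>mass \<nu>\<close>.\<close>

definition transport_plans ::
  "'a::topological_space measure \<Rightarrow> 'a measure \<Rightarrow> ('a \<times> 'a) measure set" where
  "transport_plans \<mu> \<nu> =
     {\<pi>. sets \<pi> = sets borel \<and> prob_space \<pi> \<and>
         (\<forall>A\<in>sets borel. mass \<mu> * measure \<pi> (A \<times> UNIV) = measure \<mu> A) \<and>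
         (\<forall>B\<in>sets borel. mass \<nu> * measure \<pi> (UNIV \<times> B) = measure \<nu> B)}"

text \<open>Meaningful for measures of equal mass with finite \<open>p\<close>-th moment; the infimum, taken in
  \<open>ennreal\<close>, is then finite.\<close>

definition wasserstein :: "real \<Rightarrow> 'a::metric_space measure \<Rightarrow> 'a measure \<Rightarrow> real" where
  "wasserstein p \<mu> \<nu> =
     enn2real (ennreal (mass \<mu>) *
       (INF \<pi> \<in> transport_plans \<mu> \<nu>. \<integral>\<^sup>+(x, y). ennreal (dist x y powr p) \<partial>\<pi>)) powr (1 / p)"

text \<open>The infimum is over a set of nonnegative reals, nonempty because of the zero measure.\<close>

definition gen_wasserstein ::
  "real \<Rightarrow> real \<Rightarrow> real \<Rightarrow> 'a::metric_space measure \<Rightarrow> 'a measure \<Rightarrow> real" where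
  "gen_wasserstein a b p \<mu> \<nu> =
     (INF (\<mu>', \<nu>') \<in> {(\<mu>', \<nu>'). \<mu>' \<in> finite_borel_measures_moment p \<and>
                              \<nu>' \<in> finite_borel_measures_moment p \<and> mass \<mu>' = mass \<nu>'}.
        a * tv_mass_diff \<mu> \<mu>' + a * tv_mass_diff \<nu> \<nu>' + b * wasserstein p \<mu>' \<nu>')"

text \<open>Extended-real valued, since the infimum is \<open>-\<infinity>\<close> for \<open>t < -a\<close>.  For \<open>t \<ge> -a\<close>, hence for the
  values of functions in \<open>dual_potentials a b\<close>, it lies in \<open>{-a..a}\<close>.\<close>

definition dual_entropy :: "real \<Rightarrow> real \<Rightarrow> ereal" where
  "dual_entropy a t = (INF s\<in>{0..}. ereal (s * t + a * \<bar>1 - s\<bar>))"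

text \<open>\<open>bcontfun\<close> is the library's set of bounded continuous functions.\<close>

definition dual_potentials ::
  "real \<Rightarrow> real \<Rightarrow> (('a::metric_space \<Rightarrow> real) \<times> ('a \<Rightarrow> real)) set" where
  "dual_potentials a b =
     {(\<phi>1, \<phi>2). \<phi>1 \<in> bcontfun \<and> \<phi>2 \<in> bcontfun \<and>
        (\<forall>x y. \<phi>1 x + \<phi>2 y \<le> b * dist x y \<and> \<phi>1 x \<ge> - a \<and> \<phi>2 y \<ge> - a)}"

end

theory Submission
  imports Defs
begin

text \<open>
  For \<open>t \<ge> - a\<close> the entropy term is \<open>I t = min t a\<close>. Cutting potentials off at \<open>a\<close> keeps them
  admissible, so the right-hand side is the supremum of \<open>\<integral>\<phi>1 d\<mu>1 + \<integral>\<phi>2 d\<mu>2\<close> over continuous \<open>\<phi>1, \<phi>2\<close>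
  with values in \<open>[- a, a]\<close> and \<open>\<phi>1 x + \<phi>2 y \<le> b d(x, y)\<close>.

  Weak duality (\<open>gen_wasserstein_ge_dual\<close>): moving from \<open>\<mu>i\<close> to an intermediate measure changes the
  integral of \<open>\<phi>i\<close> by at most \<open>a\<close> times the total variation of the difference, and between the
  intermediate measures the constraint integrates to \<open>b\<close> times the Wasserstein distance.

  Strong duality (\<open>gen_wasserstein_le_lipschitz_bound\<close>) is obtained by discretization.
  Removing mass from both measures and transporting the rest by a partial coupling \<open>\<Gamma>\<close>,
  whose marginals lie below \<open>\<mu>1\<close> and \<open>\<mu>2\<close>, costs
  \<open>a (\<bar>\<mu>1\<bar> + \<bar>\<mu>2\<bar>) - \<integral> (2 a - b d) d\<Gamma>\<close>
  (\<open>gen_wasserstein_le_partial_coupling\<close>). By separability, finitely many disjoint Borel cells of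
  radius \<open>\<epsilon>\<close> carry almost all of both masses (\<open>exists_small_cells\<close>). On the cell masses, maximizing the
  reward \<open>2 a - b d\<close> is a finite linear program, for which Fourier--Motzkin elimination provides a
  theorem of the alternative (\<open>partial_transport_alternative\<close>). A good discrete plan becomes a partial coupling
  with a density with respect to \<open>\<mu>1 \<Otimes> \<mu>2\<close> (\<open>cellwise_coupling\<close>), and hence an upper bound on the
  generalized distance. Otherwise there are discrete prices, which extend to a \<open>b\<close>-Lipschitz function \<open>f\<close>
  with \<open>\<bar>f\<bar> \<le> a\<close> (\<open>lipschitz_potential_extension\<close>); the admissible pair \<open>(f, - f)\<close> then has a large
  dual value. All errors are \<open>O(\<epsilon>)\<close>.
\<close>

section \<open>A theorem of the alternative for partial transport\<close>

lemma real_between_finite_sets: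
  fixes L H :: "real set"
  assumes "finite L" "finite H" "\<And>l h. l \<in> L \<Longrightarrow> h \<in> H \<Longrightarrow> l \<le> h"
  shows "\<exists>t. (\<forall>l\<in>L. l \<le> t) \<and> (\<forall>h\<in>H. t \<le> h)"
proof (cases "L = {}")
  case True
  then show ?thesis
    using assms(2) by (cases "H = {}") (auto intro: exI[of _ "Min H"])
next
  case False
  then show ?thesis
    using assms by (intro exI[of _ "Max L"]) auto
qed

text \<open>A certificate of infeasibility is a nonnegative combination \<open>z\<close> of the constraints
  \<open>A i \<bullet> x \<le> b i\<close> in which every variable cancels and the right-hand side is negative. The
  set \<open>Y\<close> holds the combinations current at one stage of the elimination, and \<open>V\<close> the
  variables still alive. A variable \<open>v\<close> is removed by keeping the rows without \<open>v\<close> and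
  adding the two members of each pair of opposite sign in \<open>v\<close>, weighted so that \<open>v\<close>
  cancels. Representing each derived row by its multipliers on the original constraints makes a contradictory row
  found at the end a certificate for the original system. A solution of the reduced system extends to
  \<open>v\<close>, since each lower bound on \<open>v\<close> lies below each upper bound.\<close>

lemma fourier_motzkin:
  fixes A :: "'i \<Rightarrow> 'v \<Rightarrow> real" and b :: "'i \<Rightarrow> real" and I :: "'i set"
  defines "R \<equiv> \<lambda>y j. \<Sum>i\<in>I. y i * A i j" and "r \<equiv> \<lambda>y. \<Sum>i\<in>I. y i * b i"
  assumes "finite V" "V \<subseteq> U" "finite Y" "\<And>y i. y \<in> Y \<Longrightarrow> 0 \<le> y i"
    and "\<And>y j. y \<in> Y \<Longrightarrow> j \<in> U - V \<Longrightarrow> R y j = 0"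
  shows "(\<exists>x. \<forall>y\<in>Y. (\<Sum>j\<in>V. R y j * x j) \<le> r y) \<or>
    (\<exists>z. (\<forall>i. 0 \<le> z i) \<and> (\<forall>j\<in>U. R z j = 0) \<and> r z < 0)"
  using assms(3-7)
proof (induction V arbitrary: Y rule: finite_induct)
  case empty
  then show ?case by (simp add: not_le[symmetric]) (metis Diff_empty)
next
  case (insert v V)
  define P where "P = {y\<in>Y. R y v > 0}"
  define Q where "Q = {y\<in>Y. R y v < 0}"
  define comb where "comb = (\<lambda>(p, q) i. R p v * q i - R q v * p i)"
  have R_comb: "R (comb (p, q)) j = R p v * R q j - R q v * R p j" for p q j
  proof -
    have "R (\<lambda>i. s * q i - t * p i) j = s * R q j - t * R p j" for s t
      unfolding R_def by (simp add: sum_subtractf sum_distrib_left algebra_simps)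
    then show ?thesis by (simp add: comb_def)
  qed
  have r_comb: "r (comb (p, q)) = R p v * r q - R q v * r p" for p q
  proof -
    have "r (\<lambda>i. s * q i - t * p i) = s * r q - t * r p" for s t
      unfolding r_def by (simp add: sum_subtractf sum_distrib_left algebra_simps)
    then show ?thesis by (simp add: comb_def)
  qed
  define Y' where "Y' = {y\<in>Y. R y v = 0} \<union> comb ` (P \<times> Q)"
  have fin: "finite P" "finite Q" "finite Y'"
    using insert.prems(2) by (auto simp: P_def Q_def Y'_def)
  have nonneg: "0 \<le> y i" if "y \<in> Y'" for y i
    using that insert.prems(3)
    by (auto simp: Y'_def comb_def P_def Q_def mult_nonneg_nonneg mult_nonpos_nonneg
        intro!: order_trans[OF mult_nonpos_nonneg mult_nonneg_nonneg])
  have zero: "R y j = 0" if "y \<in> Y'" "j \<in> U - V" for y j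
  proof (cases "j = v")
    case True
    with that show ?thesis by (auto simp: Y'_def R_comb)
  next
    case False
    with that insert.prems(4) have "R y' j = 0" if "y' \<in> Y" for y'
      using that by blast
    with that show ?thesis by (auto simp: Y'_def R_comb P_def Q_def)
  qed
  from insert.IH[of Y'] insert.prems(1) fin nonneg zero
  consider x where "\<forall>y\<in>Y'. (\<Sum>j\<in>V. R y j * x j) \<le> r y"
    | "\<exists>z. (\<forall>i. 0 \<le> z i) \<and> (\<forall>j\<in>U. R z j = 0) \<and> r z < 0"
    by blast
  then show ?case
  proof cases
    case x: 1
    define S where "S = (\<lambda>y. \<Sum>j\<in>V. R y j * x j)"
    define f where "f = (\<lambda>y. (r y - S y) / R y v)"
    have S_comb: "S (comb (p, q)) = R p v * S q - R q v * S p" for p q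
      unfolding S_def R_comb by (simp add: sum_subtractf sum_distrib_left algebra_simps)
    have "f q \<le> f p" if "p \<in> P" "q \<in> Q" for p q
    proof -
      have "S (comb (p, q)) \<le> r (comb (p, q))"
        using x that by (auto simp: Y'_def S_def)
      then have "R q v * (r p - S p) \<le> R p v * (r q - S q)"
        by (simp add: S_comb r_comb algebra_simps)
      then show ?thesis
        using that by (auto simp: f_def P_def Q_def divide_simps mult.commute)
    qed
    then have "\<exists>t. (\<forall>l\<in>f ` Q. l \<le> t) \<and> (\<forall>h\<in>f ` P. t \<le> h)"
      using fin by (intro real_between_finite_sets) auto
    then obtain t where t: "\<And>q. q \<in> Q \<Longrightarrow> f q \<le> t" "\<And>p. p \<in> P \<Longrightarrow> t \<le> f p"
      by auto
    define x' where "x' = x(v := t)"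
    have sum_x': "(\<Sum>j\<in>insert v V. R y j * x' j) = R y v * t + S y" for y
    proof -
      have "(\<Sum>j\<in>V. R y j * x' j) = S y"
        unfolding S_def x'_def using insert.hyps(2) by (intro sum.cong) auto
      then show ?thesis using insert.hyps by (simp add: x'_def)
    qed
    have "R y v * t + S y \<le> r y" if y: "y \<in> Y" for y
    proof -
      consider "R y v = 0" | "y \<in> P" | "y \<in> Q"
        using y unfolding P_def Q_def by force
      then show ?thesis
      proof cases
        case 1
        then show ?thesis using x y by (auto simp: Y'_def S_def)
      next
        case 2
        then show ?thesis using t(2)[of y] by (auto simp: f_def P_def field_simps)
      next
        case 3
        then show ?thesis using t(1)[of y] by (auto simp: f_def Q_def field_simps)
      qed
    qed
    then show ?thesis using sum_x' by (intro disjI1 exI[of _ x']) simp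
  next
    case 2
    then show ?thesis by blast
  qed
qed

lemma farkas:
  fixes A :: "'i \<Rightarrow> 'v \<Rightarrow> real" and b :: "'i \<Rightarrow> real"
  assumes "finite I" "finite V"
  shows "(\<exists>x. \<forall>i\<in>I. (\<Sum>j\<in>V. A i j * x j) \<le> b i) \<or>
    (\<exists>z. (\<forall>i. 0 \<le> z i) \<and> (\<forall>j\<in>V. (\<Sum>i\<in>I. z i * A i j) = 0) \<and> (\<Sum>i\<in>I. z i * b i) < 0)"
proof -
  define e where "e = (\<lambda>i k :: 'i. if k = i then 1 else (0::real))"
  have e: "(\<Sum>k\<in>I. e i k * g k) = g i" if "i \<in> I" for i and g :: "'i \<Rightarrow> real"
    using that assms(1) by (simp add: e_def if_distrib[of "\<lambda>u. u * _"] cong: if_cong)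
  have "0 \<le> y k" if "y \<in> e ` I" for y k
    using that by (auto simp: e_def)
  with fourier_motzkin[where U = V and V = V and Y = "e ` I" and I = I and A = A and b = b] assms
  show ?thesis by (simp add: e)
qed

text \<open>Farkas' lemma applied to the system \<open>A x \<le> b\<close>, \<open>- x \<le> 0\<close>,
  \<open>- c x \<le> - \<gamma>\<close>. The multiplier \<open>t\<close> of the last row is positive because
  \<open>b \<ge> 0\<close> makes the other rows jointly feasible (at \<open>x = 0\<close>), and dividing by
  \<open>t\<close> turns the certificate into a dual solution.\<close>

lemma linear_programming_alternative:
  fixes A :: "'i \<Rightarrow> 'v \<Rightarrow> real" and b :: "'i \<Rightarrow> real" and c :: "'v \<Rightarrow> real" and \<gamma> :: real
  assumes "finite I" "finite V" "\<And>i. i \<in> I \<Longrightarrow> 0 \<le> b i"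
  shows "(\<exists>x. (\<forall>j\<in>V. 0 \<le> x j) \<and> (\<forall>i\<in>I. (\<Sum>j\<in>V. A i j * x j) \<le> b i) \<and> \<gamma> \<le> (\<Sum>j\<in>V. c j * x j)) \<or>
    (\<exists>y. (\<forall>i. 0 \<le> y i) \<and> (\<forall>j\<in>V. c j \<le> (\<Sum>i\<in>I. y i * A i j)) \<and> (\<Sum>i\<in>I. y i * b i) < \<gamma>)"
proof -
  define J :: "('i + 'v) option set" where "J = insert None (Some ` (I <+> V))"
  define A' where "A' = (\<lambda>s j. case s of None \<Rightarrow> - c j | Some (Inl i) \<Rightarrow> A i j
    | Some (Inr k) \<Rightarrow> if j = k then - 1 else 0)"
  define b' where "b' = (\<lambda>s :: ('i + 'v) option. case s of None \<Rightarrow> - \<gamma> | Some (Inl i) \<Rightarrow> b i | Some (Inr k) \<Rightarrow> 0)"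
  have finJ: "finite J" using assms(1,2) by (simp add: J_def)
  have sumJ: "(\<Sum>s\<in>J. g s) = g None + (\<Sum>i\<in>I. g (Some (Inl i))) + (\<Sum>k\<in>V. g (Some (Inr k)))"
    for g :: "_ \<Rightarrow> real"
    using assms(1,2) by (simp add: J_def sum.reindex sum.Plus)
  consider x where "\<forall>s\<in>J. (\<Sum>j\<in>V. A' s j * x j) \<le> b' s"
    | z where "\<forall>s. 0 \<le> z s" "\<forall>j\<in>V. (\<Sum>s\<in>J. z s * A' s j) = 0" "(\<Sum>s\<in>J. z s * b' s) < 0"
    using farkas[OF finJ assms(2), of A' b'] by blast
  then show ?thesis
  proof cases
    case 1
    have "0 \<le> x k" if "k \<in> V" for k
    proof -
      have "(\<Sum>j\<in>V. A' (Some (Inr k)) j * x j) \<le> 0"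
        using 1 that by (force simp: J_def b'_def)
      moreover have "(\<Sum>j\<in>V. A' (Some (Inr k)) j * x j) = - x k"
        using that assms(2) by (simp add: A'_def if_distrib[of "\<lambda>u. u * _"] cong: if_cong)
      ultimately show ?thesis by simp
    qed
    moreover have "(\<Sum>j\<in>V. A i j * x j) \<le> b i" if "i \<in> I" for i
    proof -
      have "Some (Inl i) \<in> J" using that by (auto simp: J_def)
      with 1 show ?thesis by (force simp: A'_def b'_def)
    qed
    moreover have "\<gamma> \<le> (\<Sum>j\<in>V. c j * x j)"
    proof -
      have "None \<in> J" by (simp add: J_def)
      with 1 show ?thesis by (force simp: A'_def b'_def sum_negf)
    qed
    ultimately show ?thesis by blast
  next
    case 2
    define t where "t = z None"
    have col: "t * c j \<le> (\<Sum>i\<in>I. z (Some (Inl i)) * A i j)" if "j \<in> V" for j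
    proof -
      have "0 \<le> z (Some (Inr j))" "(\<Sum>s\<in>J. z s * A' s j) = 0" using 2 that by auto
      moreover have "(\<Sum>k\<in>V. z (Some (Inr k)) * A' (Some (Inr k)) j) = - z (Some (Inr j))"
        using that assms(2) by (simp add: A'_def if_distrib[of "\<lambda>u. _ * u"] cong: if_cong)
      ultimately show ?thesis by (simp add: sumJ A'_def t_def)
    qed
    have rhs: "(\<Sum>i\<in>I. z (Some (Inl i)) * b i) < t * \<gamma>"
      using 2(3) by (simp add: sumJ b'_def t_def)
    have "0 \<le> (\<Sum>i\<in>I. z (Some (Inl i)) * b i)"
      using 2(1) assms(3) by (auto intro!: sum_nonneg)
    with rhs have "t \<noteq> 0" by auto
    then have t: "t > 0" using 2(1) by (auto simp: t_def less_le)
    have div: "(\<Sum>i\<in>I. z (Some (Inl i)) / t * g i) = (\<Sum>i\<in>I. z (Some (Inl i)) * g i) / t" for g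
      by (simp add: sum_divide_distrib)
    show ?thesis
    proof (intro disjI2 exI[of _ "\<lambda>i. z (Some (Inl i)) / t"] conjI ballI allI)
      show "0 \<le> z (Some (Inl i)) / t" for i using 2(1) t by simp
      show "c j \<le> (\<Sum>i\<in>I. z (Some (Inl i)) / t * A i j)" if "j \<in> V" for j
        unfolding div using col[OF that] t by (simp add: pos_le_divide_eq mult.commute[of t])
      show "(\<Sum>i\<in>I. z (Some (Inl i)) / t * b i) < \<gamma>"
        unfolding div using rhs t by (simp add: pos_divide_less_eq mult.commute[of t])
    qed
  qed
qed

text \<open>Linear programming duality for partial transport from supplies \<open>m1\<close> to demands
  \<open>m2\<close> at unit rewards \<open>c\<close>: the dual variables are the prices \<open>u\<close> of the
  supplies and \<open>v\<close> of the demands. Letting \<open>\<gamma>\<close> vary gives the equality of the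
  optimal reward and the optimal price.\<close>

lemma partial_transport_alternative:
  fixes c :: "'j \<Rightarrow> 'k \<Rightarrow> real" and \<gamma> :: real
    and J :: "'j set" and K :: "'k set"
  assumes "finite J" "finite K" "\<And>j. j \<in> J \<Longrightarrow> 0 \<le> m1 j" "\<And>k. k \<in> K \<Longrightarrow> 0 \<le> m2 k"
  obtains (plan) \<pi> where "\<And>j k. j \<in> J \<Longrightarrow> k \<in> K \<Longrightarrow> 0 \<le> \<pi> j k"
      "\<And>j. j \<in> J \<Longrightarrow> (\<Sum>k\<in>K. \<pi> j k) \<le> m1 j" "\<And>k. k \<in> K \<Longrightarrow> (\<Sum>j\<in>J. \<pi> j k) \<le> m2 k"
      "\<gamma> \<le> (\<Sum>j\<in>J. \<Sum>k\<in>K. c j k * \<pi> j k)"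
  | (prices) u v where "\<And>j. 0 \<le> u j" "\<And>k. 0 \<le> v k" "\<And>j k. j \<in> J \<Longrightarrow> k \<in> K \<Longrightarrow> c j k \<le> u j + v k"
      "(\<Sum>j\<in>J. u j * m1 j) + (\<Sum>k\<in>K. v k * m2 k) < \<gamma>"
proof -
  define A :: "'j + 'k \<Rightarrow> 'j \<times> 'k \<Rightarrow> real" where "A = (\<lambda>s (j, k). case s of Inl j' \<Rightarrow> if j' = j then 1 else 0 | Inr k' \<Rightarrow> if k' = k then 1 else 0)"
  define b where "b = case_sum m1 m2"
  have b: "0 \<le> b s" if "s \<in> J <+> K" for s
    using that assms(3,4) by (auto simp: b_def)
  have sumJK: "(\<Sum>s\<in>J <+> K. g s) = (\<Sum>j\<in>J. g (Inl j)) + (\<Sum>k\<in>K. g (Inr k))" for g :: "_ \<Rightarrow> real"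
    using assms(1,2) by (simp add: sum.Plus)
  have dbl: "(\<Sum>s\<in>J \<times> K. g s) = (\<Sum>j\<in>J. \<Sum>k\<in>K. g (j, k))" for g :: "_ \<Rightarrow> real"
    by (simp add: sum.cartesian_product)
  consider x :: "'j \<times> 'k \<Rightarrow> real" where "\<forall>s\<in>J \<times> K. 0 \<le> x s" "\<forall>i\<in>J <+> K. (\<Sum>s\<in>J \<times> K. A i s * x s) \<le> b i"
      "\<gamma> \<le> (\<Sum>s\<in>J \<times> K. case_prod c s * x s)"
    | y where "\<forall>i :: 'j + 'k. 0 \<le> y i" "\<forall>s\<in>J \<times> K. case_prod c s \<le> (\<Sum>i\<in>J <+> K. y i * A i s)"
      "(\<Sum>i\<in>J <+> K. y i * b i) < \<gamma>"
  proof -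
    have "(\<exists>x. (\<forall>s\<in>J \<times> K. 0 \<le> x s) \<and> (\<forall>i\<in>J <+> K. (\<Sum>s\<in>J \<times> K. A i s * x s) \<le> b i) \<and>
        \<gamma> \<le> (\<Sum>s\<in>J \<times> K. case_prod c s * x s)) \<or>
      (\<exists>y. (\<forall>i. 0 \<le> y i) \<and> (\<forall>s\<in>J \<times> K. case_prod c s \<le> (\<Sum>i\<in>J <+> K. y i * A i s)) \<and>
        (\<Sum>i\<in>J <+> K. y i * b i) < \<gamma>)"
      using assms(1,2) by (intro linear_programming_alternative b finite_Plus finite_cartesian_product)
    then show thesis by (elim disjE exE conjE) (erule (2) that)+
  qed
  then show ?thesis
  proof cases
    case 1
    have row: "(\<Sum>s\<in>J \<times> K. A (Inl j) s * x s) = (\<Sum>k\<in>K. x (j, k))" if "j \<in> J" for j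
    proof -
      have "(\<Sum>s\<in>J \<times> K. A (Inl j) s * x s) = (\<Sum>j'\<in>J. if j = j' then \<Sum>k\<in>K. x (j', k) else 0)"
        unfolding dbl by (intro sum.cong) (auto simp: A_def)
      then show ?thesis using that assms(1) by simp
    qed
    have column: "(\<Sum>s\<in>J \<times> K. A (Inr k) s * x s) = (\<Sum>j\<in>J. x (j, k))" if "k \<in> K" for k
    proof -
      have "(\<Sum>s\<in>J \<times> K. A (Inr k) s * x s) = (\<Sum>j\<in>J. \<Sum>k'\<in>K. if k = k' then x (j, k') else 0)"
        unfolding dbl by (intro sum.cong) (auto simp: A_def)
      then show ?thesis using that assms(2) by simp
    qed
    show ?thesis
    proof (rule plan[of "\<lambda>j k. x (j, k)"])
      show "(\<Sum>k\<in>K. x (j, k)) \<le> m1 j" if "j \<in> J" for j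
        using 1(2)[rule_format, of "Inl j"] row[OF that] that by (simp add: b_def InlI)
      show "(\<Sum>j\<in>J. x (j, k)) \<le> m2 k" if "k \<in> K" for k
        using 1(2)[rule_format, of "Inr k"] column[OF that] that by (simp add: b_def InrI)
    qed (use 1(1,3) in \<open>simp_all add: dbl\<close>)
  next
    case 2
    have "(\<Sum>i\<in>J <+> K. y i * A i (j, k)) = y (Inl j) + y (Inr k)" if "j \<in> J" "k \<in> K" for j k
      using that assms(1,2) by (simp add: sumJK A_def if_distrib[of "\<lambda>u. _ * u"] cong: if_cong)
    with 2(2) have "c j k \<le> y (Inl j) + y (Inr k)" if "j \<in> J" "k \<in> K" for j k
      using that by fastforce
    with 2(1,3) show ?thesis
      by (intro prices[of "\<lambda>j. y (Inl j)" "\<lambda>k. y (Inr k)"]) (simp_all add: sumJK b_def)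
  qed
qed

section \<open>Total variation of finite Borel measures\<close>

lemma space_finite_borel_measures: "\<mu> \<in> finite_borel_measures \<Longrightarrow> space \<mu> = UNIV"
  by (metis (mono_tags, lifting) finite_borel_measures_def mem_Collect_eq sets_eq_imp_space_eq space_borel)

lemma sets_finite_borel_measures:
  "\<mu> \<in> finite_borel_measures \<Longrightarrow> sets \<mu> = sets borel"
  by (simp add: finite_borel_measures_def)

lemma finite_borel_measures_finite: "\<mu> \<in> finite_borel_measures \<Longrightarrow> finite_measure \<mu>"
  by (simp add: finite_borel_measures_def)

lemma finite_borel_measures_moment_finite:
  "\<mu> \<in> finite_borel_measures_moment p \<Longrightarrow> \<mu> \<in> finite_borel_measures"
  by (simp add: finite_borel_measures_moment_def)

lemma mass_finite_borel_measures: "\<mu> \<in> finite_borel_measures \<Longrightarrow> mass \<mu> = measure \<mu> UNIV"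
  by (simp add: mass_def space_finite_borel_measures)

lemma mass_nonneg: "0 \<le> mass \<mu>"
  by (simp add: mass_def)

lemma integrable_bounded_borel:
  fixes g :: "'a::topological_space \<Rightarrow> real"
  assumes "\<mu> \<in> finite_borel_measures" "g \<in> borel_measurable borel" "\<And>x. \<bar>g x\<bar> \<le> c"
  shows "integrable \<mu> g"
proof -
  interpret finite_measure \<mu> using assms(1) by (rule finite_borel_measures_finite)
  have "g \<in> borel_measurable \<mu>"
    using assms(2) measurable_cong_sets[OF sets_finite_borel_measures[OF assms(1)] refl] by blast
  then show ?thesis
    using assms(3) by (intro integrable_const_bound[of _ c]) auto
qed

text \<open>This is how all error terms, which are linear in the mesh size \<open>\<delta>\<close>, are
  removed.\<close>

lemma le_of_le_add_mult:
  fixes x y C :: real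
  assumes "0 \<le> C" "\<And>\<delta>. 0 < \<delta> \<Longrightarrow> x \<le> y + \<delta> * C"
  shows "x \<le> y"
proof (rule field_le_epsilon)
  fix e :: real assume e: "0 < e"
  have "x \<le> y + e / (C + 1) * C"
    using assms(1) e by (intro assms(2)) simp
  also have "e / (C + 1) * C \<le> e"
    using assms(1) e by (simp add: field_simps)
  finally show "x \<le> y + e" by simp
qed

lemma measure_sum_partition:
  assumes "\<mu> \<in> finite_borel_measures" "finite P" "disjoint P" "P \<subseteq> sets borel" "\<Union>P = UNIV"
  shows "(\<Sum>A\<in>P. measure \<mu> A) = mass \<mu>"
proof -
  interpret finite_measure \<mu> using assms(1) by (rule finite_borel_measures_finite)
  have "measure \<mu> (\<Union>A\<in>P. A) = (\<Sum>A\<in>P. measure \<mu> A)"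
    using assms by (intro finite_measure_finite_Union)
      (auto simp: sets_finite_borel_measures disjoint_family_on_def disjoint_def)
  then show ?thesis using assms by (simp add: mass_finite_borel_measures)
qed

lemma partition_sum_le_tv_mass_diff:
  assumes "\<mu> \<in> finite_borel_measures" "\<nu> \<in> finite_borel_measures"
    and "finite P" "disjoint P" "P \<subseteq> sets borel" "\<Union>P = UNIV"
  shows "(\<Sum>A\<in>P. \<bar>measure \<mu> A - measure \<nu> A\<bar>) \<le> tv_mass_diff \<mu> \<nu>"
  unfolding tv_mass_diff_def
proof (rule cSUP_upper)
  show "bdd_above ((\<lambda>P. \<Sum>A\<in>P. \<bar>measure \<mu> A - measure \<nu> A\<bar>) `
      {P. finite P \<and> disjoint P \<and> P \<subseteq> sets borel \<and> \<Union> P = UNIV})"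
  proof (rule bdd_aboveI2)
    fix Q :: "'a set set"
    assume Q: "Q \<in> {P. finite P \<and> disjoint P \<and> P \<subseteq> sets borel \<and> \<Union> P = UNIV}"
    have "(\<Sum>A\<in>Q. \<bar>measure \<mu> A - measure \<nu> A\<bar>) \<le> (\<Sum>A\<in>Q. measure \<mu> A + measure \<nu> A)"
      by (intro sum_mono) (simp add: abs_le_iff add_increasing2 add_increasing)
    also have "\<dots> = mass \<mu> + mass \<nu>"
      using Q assms(1,2) by (simp add: sum.distrib measure_sum_partition)
    finally show "(\<Sum>A\<in>Q. \<bar>measure \<mu> A - measure \<nu> A\<bar>) \<le> mass \<mu> + mass \<nu>" .
  qed
qed (use assms in simp)

lemma tv_mass_diff_nonneg:
  assumes "\<mu> \<in> finite_borel_measures" "\<nu> \<in> finite_borel_measures"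
  shows "0 \<le> tv_mass_diff \<mu> \<nu>"
  using partition_sum_le_tv_mass_diff[OF assms, of "{UNIV}"] by (simp add: disjoint_def)

lemma tv_mass_diff_dominated:
  fixes \<mu> \<nu> :: "'a::topological_space measure"
  assumes "\<mu> \<in> finite_borel_measures" "\<nu> \<in> finite_borel_measures"
    and "\<And>A. A \<in> sets borel \<Longrightarrow> measure \<nu> A \<le> measure \<mu> A"
  shows "tv_mass_diff \<mu> \<nu> \<le> mass \<mu> - mass \<nu>"
  unfolding tv_mass_diff_def
proof (rule cSUP_least)
  have "{UNIV} \<in> {P :: 'a set set. finite P \<and> disjoint P \<and> P \<subseteq> sets borel \<and> \<Union> P = UNIV}"
    by (simp add: disjoint_def)
  then show "{P :: 'a set set. finite P \<and> disjoint P \<and> P \<subseteq> sets borel \<and> \<Union> P = UNIV} \<noteq> {}"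
    by blast
next
  fix P :: "'a set set"
  assume P: "P \<in> {P. finite P \<and> disjoint P \<and> P \<subseteq> sets borel \<and> \<Union> P = UNIV}"
  have "(\<Sum>A\<in>P. \<bar>measure \<mu> A - measure \<nu> A\<bar>) = (\<Sum>A\<in>P. measure \<mu> A - measure \<nu> A)"
    using P assms(3) by (intro sum.cong) (auto simp: abs_of_nonneg)
  also have "\<dots> = mass \<mu> - mass \<nu>"
    using P assms(1,2) by (simp add: sum_subtractf measure_sum_partition)
  finally show "(\<Sum>A\<in>P. \<bar>measure \<mu> A - measure \<nu> A\<bar>) \<le> mass \<mu> - mass \<nu>" by simp
qed

text \<open>Since the total variation is a supremum over finite partitions, \<open>g\<close> is rounded down to a
  multiple of \<open>\<delta>\<close>. The level sets of the rounded function form a finite partition, on which the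
  two integrals can be compared set by set; the rounding shifts the integral by at most \<open>\<delta>\<close>
  times the mass and the bound on \<open>\<bar>g\<bar>\<close> to \<open>a + \<delta>\<close>.\<close>

lemma integral_diff_le_tv_mass_diff:
  fixes g :: "'a::topological_space \<Rightarrow> real"
  assumes \<mu>: "\<mu> \<in> finite_borel_measures" and \<nu>: "\<nu> \<in> finite_borel_measures"
    and g: "g \<in> borel_measurable borel" and bound: "\<And>x. \<bar>g x\<bar> \<le> a"
  shows "(\<integral>x. g x \<partial>\<mu>) - (\<integral>x. g x \<partial>\<nu>) \<le> a * tv_mass_diff \<mu> \<nu>"
proof (rule le_of_le_add_mult)
  show "0 \<le> mass \<mu> + tv_mass_diff \<mu> \<nu>"
    by (intro add_nonneg_nonneg mass_nonneg tv_mass_diff_nonneg \<mu> \<nu>)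
  fix \<delta> :: real assume \<delta>: "0 < \<delta>"
  note [measurable] = g
  define A where "A = (\<lambda>k::int. {x. \<lfloor>g x / \<delta>\<rfloor> = k})"
  define K where "K = {\<lfloor>- a / \<delta>\<rfloor>..\<lfloor>a / \<delta>\<rfloor>}"
  have A_borel: "A k \<in> sets borel" for k
  proof -
    have "{x \<in> space borel. \<lfloor>g x / \<delta>\<rfloor> = k} \<in> sets borel" by measurable
    then show ?thesis by (simp add: A_def)
  qed
  have range: "\<lfloor>g x / \<delta>\<rfloor> \<in> K" for x
  proof -
    have "- a \<le> g x" "g x \<le> a" using bound[of x] by (simp_all add: abs_le_iff)
    then have "- a / \<delta> \<le> g x / \<delta>" "g x / \<delta> \<le> a / \<delta>"
      using \<delta> by (intro divide_right_mono; simp)+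
    then show ?thesis by (simp only: K_def atLeastAtMost_iff floor_mono)
  qed
  define s where "s = (\<lambda>x. \<Sum>k\<in>K. \<delta> * of_int k * indicator (A k) x :: real)"
  have s: "s x = \<delta> * of_int \<lfloor>g x / \<delta>\<rfloor>" for x
  proof -
    have "s x = (\<Sum>k\<in>K. if k = \<lfloor>g x / \<delta>\<rfloor> then \<delta> * of_int k else 0)"
      unfolding s_def by (intro sum.cong) (auto simp: A_def)
    then show ?thesis using range[of x] by (simp add: K_def)
  qed
  have s_le: "s x \<le> g x" and le_s: "g x \<le> s x + \<delta>" for x
  proof -
    have "\<delta> * of_int \<lfloor>g x / \<delta>\<rfloor> \<le> \<delta> * (g x / \<delta>)" "\<delta> * (g x / \<delta>) \<le> \<delta> * (of_int \<lfloor>g x / \<delta>\<rfloor> + 1)"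
      using \<delta> by (intro mult_left_mono; linarith)+
    then show "s x \<le> g x" "g x \<le> s x + \<delta>"
      using \<delta> by (simp_all add: s distrib_left)
  qed
  have s_bound: "\<bar>s x\<bar> \<le> a + \<delta>" for x
    using s_le[of x] le_s[of x] bound[of x] \<delta> by linarith
  have s_borel [measurable]: "s \<in> borel_measurable borel"
    unfolding s_def using A_borel by measurable
  have int_s: "(\<integral>x. s x \<partial>\<rho>) = (\<Sum>k\<in>K. \<delta> * of_int k * measure \<rho> (A k))"
    and int_le: "(\<integral>x. s x \<partial>\<rho>) \<le> (\<integral>x. g x \<partial>\<rho>)"
    and le_int: "(\<integral>x. g x \<partial>\<rho>) \<le> (\<integral>x. s x \<partial>\<rho>) + \<delta> * mass \<rho>"
    if \<rho>: "\<rho> \<in> finite_borel_measures" for \<rho>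
  proof -
    interpret finite_measure \<rho> using \<rho> by (rule finite_borel_measures_finite)
    have [simp]: "A k \<in> sets \<rho>" for k
      using A_borel sets_finite_borel_measures[OF \<rho>] by blast
    have "integrable \<rho> (\<lambda>x. \<delta> * of_int k * indicator (A k) x :: real)" for k
      by (intro integrable_mult_right integrable_real_indicator) (simp_all add: emeasure_finite less_top[symmetric])
    then show "(\<integral>x. s x \<partial>\<rho>) = (\<Sum>k\<in>K. \<delta> * of_int k * measure \<rho> (A k))"
      unfolding s_def by (subst Bochner_Integration.integral_sum) (simp_all add: space_finite_borel_measures[OF \<rho>])
    have ints: "integrable \<rho> s" "integrable \<rho> g"
      by (rule integrable_bounded_borel[OF \<rho> s_borel s_bound] integrable_bounded_borel[OF \<rho> g bound])+
    then show "(\<integral>x. s x \<partial>\<rho>) \<le> (\<integral>x. g x \<partial>\<rho>)"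
      by (intro integral_mono s_le)
    have "(\<integral>x. g x \<partial>\<rho>) \<le> (\<integral>x. s x + \<delta> \<partial>\<rho>)"
      using ints by (intro integral_mono le_s) auto
    then show "(\<integral>x. g x \<partial>\<rho>) \<le> (\<integral>x. s x \<partial>\<rho>) + \<delta> * mass \<rho>"
      using ints by (simp add: mass_def mult.commute)
  qed
  have coeff: "\<bar>\<delta> * of_int k\<bar> * \<bar>measure \<mu> (A k) - measure \<nu> (A k)\<bar>
      \<le> (a + \<delta>) * \<bar>measure \<mu> (A k) - measure \<nu> (A k)\<bar>" for k
  proof (cases "A k = {}")
    case False
    then obtain x where "x \<in> A k" by blast
    then have "\<delta> * of_int k = s x" by (simp add: s A_def)
    with s_bound[of x] show ?thesis by (intro mult_right_mono) simp_all
  qed simp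
  have "(\<Sum>k\<in>K. \<bar>measure \<mu> (A k) - measure \<nu> (A k)\<bar>)
      = (\<Sum>B\<in>A ` K. \<bar>measure \<mu> B - measure \<nu> B\<bar>)"
  proof (rule sum.reindex_nontrivial[unfolded comp_def, symmetric])
    show "\<bar>measure \<mu> (A k) - measure \<nu> (A k)\<bar> = 0" if "k \<noteq> l" "A k = A l" for k l
    proof -
      have "A k \<inter> A l = {}" using that(1) by (auto simp: A_def)
      then have "A k = {}" using that(2) by simp
      then show ?thesis by simp
    qed
  qed (simp add: K_def)
  also have "\<dots> \<le> tv_mass_diff \<mu> \<nu>"
  proof (rule partition_sum_le_tv_mass_diff[OF \<mu> \<nu>])
    show "disjoint (A ` K)" by (auto simp: disjoint_def A_def)
    show "\<Union> (A ` K) = UNIV" using range by (auto simp: A_def)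
  qed (use A_borel in \<open>auto simp: K_def\<close>)
  finally have tv: "(\<Sum>k\<in>K. \<bar>measure \<mu> (A k) - measure \<nu> (A k)\<bar>) \<le> tv_mass_diff \<mu> \<nu>" .
  have a\<delta>: "0 \<le> a + \<delta>" using bound[of undefined] \<delta> by linarith
  have "(\<integral>x. s x \<partial>\<mu>) - (\<integral>x. s x \<partial>\<nu>) = (\<Sum>k\<in>K. \<delta> * of_int k * (measure \<mu> (A k) - measure \<nu> (A k)))"
    unfolding int_s[OF \<mu>] int_s[OF \<nu>] by (simp only: sum_subtractf right_diff_distrib)
  also have "\<dots> \<le> (\<Sum>k\<in>K. (a + \<delta>) * \<bar>measure \<mu> (A k) - measure \<nu> (A k)\<bar>)"
  proof (rule sum_mono)
    fix k
    show "\<delta> * of_int k * (measure \<mu> (A k) - measure \<nu> (A k))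
        \<le> (a + \<delta>) * \<bar>measure \<mu> (A k) - measure \<nu> (A k)\<bar>"
      using abs_ge_self coeff[of k] unfolding abs_mult[symmetric] by (rule order_trans)
  qed
  also have "\<dots> \<le> (a + \<delta>) * tv_mass_diff \<mu> \<nu>"
    unfolding sum_distrib_left[symmetric] using tv a\<delta> by (rule mult_left_mono)
  finally have step: "(\<integral>x. s x \<partial>\<mu>) - (\<integral>x. s x \<partial>\<nu>) \<le> (a + \<delta>) * tv_mass_diff \<mu> \<nu>" .
  show "(\<integral>x. g x \<partial>\<mu>) - (\<integral>x. g x \<partial>\<nu>)
      \<le> a * tv_mass_diff \<mu> \<nu> + \<delta> * (mass \<mu> + tv_mass_diff \<mu> \<nu>)"
  proof -
    have "p - r \<le> a * t + \<delta> * (m + t)"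
      if "p \<le> q + \<delta> * m" "s \<le> r" "q - s \<le> (a + \<delta>) * t" for p q r s t m
      using that by (simp add: algebra_simps)
    from this[OF le_int[OF \<mu>] int_le[OF \<nu>] step] show ?thesis .
  qed
qed

section \<open>Couplings and transport plans\<close>

lemma transport_plan_integral_fst:
  fixes g :: "'a::second_countable_topology \<Rightarrow> real"
  assumes \<mu>: "\<mu> \<in> finite_borel_measures" and \<pi>: "\<pi> \<in> transport_plans \<mu> \<nu>"
    and g: "g \<in> borel_measurable borel"
  shows "(\<integral>x. g x \<partial>\<mu>) = mass \<mu> * (\<integral>z. g (fst z) \<partial>\<pi>)"
proof -
  interpret prob_space \<pi> using \<pi> by (simp add: transport_plans_def)
  interpret M: finite_measure \<mu> using \<mu> by (rule finite_borel_measures_finite)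
  have sets_\<pi> [measurable_cong]: "sets \<pi> = sets borel" using \<pi> by (simp add: transport_plans_def)
  have space_\<pi>: "space \<pi> = UNIV" using sets_eq_imp_space_eq[OF sets_\<pi>] by simp
  have fst_m [measurable]: "fst \<in> measurable \<pi> (borel :: 'a measure)"
    by (simp add: measurable_cong_sets[OF sets_\<pi> refl] borel_prod[symmetric])
  note [measurable] = g
  have "\<mu> = distr (density \<pi> (\<lambda>_. ennreal (mass \<mu>))) borel fst"
  proof (rule measure_eqI)
    fix A assume "A \<in> sets \<mu>"
    then have A [measurable]: "A \<in> sets borel" using \<mu> by (simp add: sets_finite_borel_measures)
    have vim: "fst -` A = A \<times> (UNIV :: 'a set)" by auto
    have "emeasure (distr (density \<pi> (\<lambda>_. ennreal (mass \<mu>))) borel fst) A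
        = ennreal (mass \<mu>) * emeasure \<pi> (A \<times> UNIV)"
      using measurable_sets[OF fst_m A]
      by (simp add: emeasure_distr emeasure_density_const space_\<pi> vim)
    also have "\<dots> = ennreal (mass \<mu> * measure \<pi> (A \<times> UNIV))"
      by (simp add: emeasure_eq_measure ennreal_mult mass_nonneg)
    also have "\<dots> = emeasure \<mu> A"
      using \<pi> A by (simp add: transport_plans_def M.emeasure_eq_measure)
    finally show "emeasure \<mu> A = emeasure (distr (density \<pi> (\<lambda>_. ennreal (mass \<mu>))) borel fst) A" ..
  qed (simp add: sets_finite_borel_measures[OF \<mu>])
  then have "(\<integral>x. g x \<partial>\<mu>) = (\<integral>x. g x \<partial>distr (density \<pi> (\<lambda>_. ennreal (mass \<mu>))) borel fst)"
    by simp
  also have "\<dots> = (\<integral>z. g (fst z) \<partial>density \<pi> (\<lambda>_. ennreal (mass \<mu>)))"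
    by (rule integral_distr) simp_all
  also have "\<dots> = (\<integral>z. mass \<mu> *\<^sub>R g (fst z) \<partial>\<pi>)"
    by (rule integral_density) (simp_all add: mass_nonneg)
  finally show ?thesis by simp
qed

text \<open>Transposing the plan reduces this to the first marginal.\<close>

lemma transport_plan_integral_snd:
  fixes g :: "'a::second_countable_topology \<Rightarrow> real"
  assumes \<nu>: "\<nu> \<in> finite_borel_measures" and \<pi>: "\<pi> \<in> transport_plans \<mu> \<nu>"
    and g: "g \<in> borel_measurable borel"
  shows "(\<integral>x. g x \<partial>\<nu>) = mass \<nu> * (\<integral>z. g (snd z) \<partial>\<pi>)"
proof -
  interpret prob_space \<pi> using \<pi> by (simp add: transport_plans_def)
  have sets_\<pi> [measurable_cong]: "sets \<pi> = sets borel" using \<pi> by (simp add: transport_plans_def)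
  have space_\<pi>: "space \<pi> = UNIV" using sets_eq_imp_space_eq[OF sets_\<pi>] by simp
  have swap: "prod.swap \<in> measurable \<pi> (borel :: ('a \<times> 'a) measure)"
    using borel_measurable_continuous_onI[OF continuous_on_swap]
    by (simp add: measurable_cong_sets[OF sets_\<pi> refl])
  define \<pi>' where "\<pi>' = distr \<pi> borel prod.swap"
  have "measure \<pi>' (A \<times> B) = measure \<pi> (B \<times> A)" if "A \<in> sets borel" "B \<in> sets borel" for A B
  proof -
    have "A \<times> B \<in> sets (borel :: ('a \<times> 'a) measure)"
      using that by (simp add: borel_prod[symmetric])
    moreover have "prod.swap -` (A \<times> B) = B \<times> A" by auto
    ultimately show ?thesis
      using swap by (simp add: \<pi>'_def measure_distr space_\<pi>)
  qed
  then have "\<pi>' \<in> transport_plans \<nu> \<mu>"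
    using \<pi> prob_space_distr[OF swap] by (simp add: transport_plans_def \<pi>'_def)
  from transport_plan_integral_fst[OF \<nu> this g]
  have "(\<integral>x. g x \<partial>\<nu>) = mass \<nu> * (\<integral>z. g (fst z) \<partial>\<pi>')" .
  also have "(\<integral>z. g (fst z) \<partial>\<pi>') = (\<integral>z. g (fst (prod.swap z)) \<partial>\<pi>)"
    unfolding \<pi>'_def using g swap
    by (intro integral_distr) (simp_all add: borel_prod[symmetric])
  finally show ?thesis by simp
qed

text \<open>Unlike a transport plan, a coupling carries the common mass of its marginals. This makes the
  subcouplings obtained from densities on the product space easy to handle, and the zero measure is
  allowed.\<close>

definition couplings :: "'a::topological_space measure \<Rightarrow> 'a measure \<Rightarrow> ('a \<times> 'a) measure set" where
  "couplings \<mu> \<nu> = {\<Gamma> \<in> finite_borel_measures.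
     (\<forall>A\<in>sets borel. measure \<Gamma> (A \<times> UNIV) = measure \<mu> A) \<and>
     (\<forall>B\<in>sets borel. measure \<Gamma> (UNIV \<times> B) = measure \<nu> B)}"

lemma scaled_coupling_transport_plan:
  fixes \<mu> \<nu> :: "'a::topological_space measure"
  assumes \<Gamma>: "\<Gamma> \<in> couplings \<mu> \<nu>"
    and \<mu>: "\<mu> \<in> finite_borel_measures" and \<nu>: "\<nu> \<in> finite_borel_measures"
    and pos: "0 < mass \<mu>"
  shows "scale_measure (ennreal (1 / mass \<mu>)) \<Gamma> \<in> transport_plans \<mu> \<nu>"
proof -
  have \<Gamma>_fin: "\<Gamma> \<in> finite_borel_measures" using \<Gamma> by (simp add: couplings_def)
  interpret finite_measure \<Gamma> using \<Gamma>_fin by (rule finite_borel_measures_finite)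
  have [simp]: "space \<Gamma> = UNIV" using \<Gamma>_fin by (rule space_finite_borel_measures)
  have tot: "measure \<Gamma> UNIV = mass \<mu>" "measure \<Gamma> UNIV = mass \<nu>"
    using \<Gamma> mass_finite_borel_measures[OF \<mu>] mass_finite_borel_measures[OF \<nu>]
    by (force simp: couplings_def)+
  have scale: "measure (scale_measure (ennreal (1 / mass \<mu>)) \<Gamma>) A = measure \<Gamma> A / mass \<mu>" for A
    using pos by (simp add: measure_def ennreal_mult enn2real_mult)
  have "prob_space (scale_measure (ennreal (1 / mass \<mu>)) \<Gamma>)"
  proof (rule prob_spaceI)
    show "emeasure (scale_measure (ennreal (1 / mass \<mu>)) \<Gamma>)
        (space (scale_measure (ennreal (1 / mass \<mu>)) \<Gamma>)) = 1"
      using pos tot(1)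
      by (simp add: space_scale_measure emeasure_eq_measure ennreal_mult[symmetric])
  qed
  then show ?thesis
    using \<Gamma> tot pos sets_finite_borel_measures[OF \<Gamma>_fin]
    by (auto simp: transport_plans_def scale couplings_def)
qed

lemma wasserstein_nonneg: "0 \<le> wasserstein p \<mu> \<nu>"
  by (simp add: wasserstein_def)

lemma wasserstein_1:
  fixes \<mu> \<nu> :: "'a::metric_space measure"
  shows
  "wasserstein 1 \<mu> \<nu> =
     enn2real (ennreal (mass \<mu>) * (INF \<pi> \<in> transport_plans \<mu> \<nu>. \<integral>\<^sup>+z. ennreal (dist (fst z) (snd z)) \<partial>\<pi>))"
proof -
  have "(\<integral>\<^sup>+(x, y). ennreal (dist x y powr 1) \<partial>\<pi>) = (\<integral>\<^sup>+z. ennreal (dist (fst z) (snd z)) \<partial>\<pi>)"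
    for \<pi> :: "('a \<times> 'a) measure"
    by (intro nn_integral_cong) (simp add: case_prod_beta)
  then show ?thesis unfolding wasserstein_def by simp
qed

text \<open>The left-hand side is the quantity whose real value defines the distance. It is compared in
  \<open>ennreal\<close>, so the lemma serves both to bound the distance from above and to show that the infimum is
  finite.\<close>

lemma scaled_plan_cost_le_coupling_cost:
  assumes \<Gamma>: "\<Gamma> \<in> couplings \<mu> \<nu>"
    and \<mu>: "\<mu> \<in> finite_borel_measures" and \<nu>: "\<nu> \<in> finite_borel_measures"
  shows "ennreal (mass \<mu>) * (INF \<pi> \<in> transport_plans \<mu> \<nu>. \<integral>\<^sup>+z. ennreal (dist (fst z) (snd z)) \<partial>\<pi>)
    \<le> (\<integral>\<^sup>+z. ennreal (dist (fst z) (snd z)) \<partial>\<Gamma>)"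
proof (cases "mass \<mu> = 0")
  case False
  then have pos: "0 < mass \<mu>" using mass_nonneg[of \<mu>] by simp
  have meas: "(\<lambda>z. ennreal (dist (fst z) (snd z))) \<in> borel_measurable \<Gamma>"
  proof -
    have "sets \<Gamma> = sets borel" using \<Gamma> by (simp add: couplings_def sets_finite_borel_measures)
    moreover have "(\<lambda>z::'a\<times>'a. ennreal (dist (fst z) (snd z))) \<in> borel_measurable borel"
      by (intro measurable_compose[OF _ measurable_ennreal] borel_measurable_continuous_onI continuous_intros)
    ultimately show ?thesis by (simp cong: measurable_cong_sets)
  qed
  have "(INF \<pi> \<in> transport_plans \<mu> \<nu>. \<integral>\<^sup>+z. ennreal (dist (fst z) (snd z)) \<partial>\<pi>)
      \<le> (\<integral>\<^sup>+z. ennreal (dist (fst z) (snd z)) \<partial>scale_measure (ennreal (1 / mass \<mu>)) \<Gamma>)"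
    using scaled_coupling_transport_plan[OF \<Gamma> \<mu> \<nu> pos] by (rule INF_lower)
  also have "\<dots> = ennreal (1 / mass \<mu>) * (\<integral>\<^sup>+z. ennreal (dist (fst z) (snd z)) \<partial>\<Gamma>)"
    using meas by (rule nn_integral_scale_measure)
  finally have "ennreal (mass \<mu>) * (INF \<pi> \<in> transport_plans \<mu> \<nu>. \<integral>\<^sup>+z. ennreal (dist (fst z) (snd z)) \<partial>\<pi>)
      \<le> ennreal (mass \<mu>) * (ennreal (1 / mass \<mu>) * (\<integral>\<^sup>+z. ennreal (dist (fst z) (snd z)) \<partial>\<Gamma>))"
    by (rule mult_left_mono) simp
  also have "\<dots> = (\<integral>\<^sup>+z. ennreal (dist (fst z) (snd z)) \<partial>\<Gamma>)"
    using pos by (simp add: mult.assoc[symmetric] ennreal_mult[symmetric])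
  finally show ?thesis .
qed simp

lemma measure_pair_measure_Times_finite:
  assumes "finite_measure M" "finite_measure N" "A \<in> sets M" "B \<in> sets N"
  shows "measure (M \<Otimes>\<^sub>M N) (A \<times> B) = measure M A * measure N B"
proof -
  interpret N: finite_measure N by fact
  show ?thesis
    using assms by (simp add: measure_def N.emeasure_pair_measure_Times enn2real_mult)
qed

lemma product_coupling:
  fixes \<mu> \<nu> :: "'a::second_countable_topology measure"
  assumes \<mu>: "\<mu> \<in> finite_borel_measures" and \<nu>: "\<nu> \<in> finite_borel_measures"
    and mass: "mass \<mu> = mass \<nu>" and pos: "0 < mass \<mu>"
  shows "scale_measure (ennreal (1 / mass \<mu>)) (\<mu> \<Otimes>\<^sub>M \<nu>) \<in> couplings \<mu> \<nu>"
proof -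
  interpret M: finite_measure \<mu> using \<mu> by (rule finite_borel_measures_finite)
  interpret N: finite_measure \<nu> using \<nu> by (rule finite_borel_measures_finite)
  interpret P: finite_measure "\<mu> \<Otimes>\<^sub>M \<nu>"
    by (intro finite_measure_pair_measure M.finite_measure_axioms N.finite_measure_axioms)
  have sets_P: "sets (\<mu> \<Otimes>\<^sub>M \<nu>) = sets borel"
    unfolding borel_prod[symmetric]
    by (intro sets_pair_measure_cong sets_finite_borel_measures \<mu> \<nu>)
  have scale: "measure (scale_measure (ennreal (1 / mass \<mu>)) (\<mu> \<Otimes>\<^sub>M \<nu>)) A
      = measure (\<mu> \<Otimes>\<^sub>M \<nu>) A / mass \<mu>" for A
    using pos by (simp add: measure_def ennreal_mult enn2real_mult)
  have "finite_measure (scale_measure (ennreal (1 / mass \<mu>)) (\<mu> \<Otimes>\<^sub>M \<nu>))"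
    by (rule finite_measureI)
      (simp add: space_scale_measure P.emeasure_eq_measure ennreal_mult_eq_top_iff)
  moreover have "measure (\<mu> \<Otimes>\<^sub>M \<nu>) (A \<times> B) = measure \<mu> A * measure \<nu> B"
    if "A \<in> sets borel" "B \<in> sets borel" for A B
    using that \<mu> \<nu> by (intro measure_pair_measure_Times_finite) (simp_all add: sets_finite_borel_measures finite_borel_measures_finite)
  ultimately show ?thesis
    using pos mass sets_P mass_finite_borel_measures[OF \<mu>] mass_finite_borel_measures[OF \<nu>]
    by (simp add: couplings_def finite_borel_measures_def scale)
qed

section \<open>Weak duality\<close>

lemma finite_moment_at:
  fixes \<mu> :: "'a::metric_space measure"
  assumes \<mu>: "\<mu> \<in> finite_borel_measures_moment 1"
  shows "(\<integral>\<^sup>+x. ennreal (dist x x0) \<partial>\<mu>) < \<infinity>"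
proof -
  have fin: "\<mu> \<in> finite_borel_measures" using \<mu> by (rule finite_borel_measures_moment_finite)
  interpret finite_measure \<mu> using fin by (rule finite_borel_measures_finite)
  obtain x1 where x1: "(\<integral>\<^sup>+x. ennreal (dist x x1) \<partial>\<mu>) < \<infinity>"
    using \<mu> by (auto simp: finite_borel_measures_moment_def)
  have meas: "(\<lambda>x. ennreal (dist x x1)) \<in> borel_measurable \<mu>"
    unfolding measurable_cong_sets[OF sets_finite_borel_measures[OF fin] refl]
    by (intro measurable_compose[OF _ measurable_ennreal] borel_measurable_continuous_onI continuous_intros)
  have "(\<integral>\<^sup>+x. ennreal (dist x x0) \<partial>\<mu>) \<le> (\<integral>\<^sup>+x. ennreal (dist x x1) + ennreal (dist x1 x0) \<partial>\<mu>)"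
    by (intro nn_integral_mono) (simp add: ennreal_plus[symmetric] dist_triangle del: ennreal_plus)
  also have "\<dots> = (\<integral>\<^sup>+x. ennreal (dist x x1) \<partial>\<mu>) + (\<integral>\<^sup>+x. ennreal (dist x1 x0) \<partial>\<mu>)"
    using meas by (intro nn_integral_add) simp_all
  also have "\<dots> < \<infinity>"
    using x1 by (simp add: ennreal_mult_eq_top_iff emeasure_finite less_top[symmetric])
  finally show ?thesis .
qed

lemma borel_measurable_dist_pair:
  "(\<lambda>z::'a::metric_space \<times> 'a. dist (fst z) (snd z)) \<in> borel_measurable borel"
  by (intro borel_measurable_continuous_onI continuous_intros)

lemma coupling_marginals:
  fixes \<Gamma> :: "('a::second_countable_topology \<times> 'a) measure"
  assumes \<Gamma>: "\<Gamma> \<in> couplings \<mu> \<nu>"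
    and \<mu>: "\<mu> \<in> finite_borel_measures" and \<nu>: "\<nu> \<in> finite_borel_measures"
  shows "distr \<Gamma> borel fst = \<mu>" "distr \<Gamma> borel snd = \<nu>"
proof -
  have \<Gamma>_fin: "\<Gamma> \<in> finite_borel_measures" using \<Gamma> by (simp add: couplings_def)
  interpret finite_measure \<Gamma> using \<Gamma>_fin by (rule finite_borel_measures_finite)
  interpret M: finite_measure \<mu> using \<mu> by (rule finite_borel_measures_finite)
  interpret N: finite_measure \<nu> using \<nu> by (rule finite_borel_measures_finite)
  have [simp]: "space \<Gamma> = UNIV" using \<Gamma>_fin by (rule space_finite_borel_measures)
  have meas: "fst \<in> measurable \<Gamma> (borel :: 'a measure)" "snd \<in> measurable \<Gamma> (borel :: 'a measure)"
    by (simp_all add: measurable_cong_sets[OF sets_finite_borel_measures[OF \<Gamma>_fin] refl] borel_prod[symmetric])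
  have vim: "fst -` A = A \<times> (UNIV :: 'a set)" "snd -` A = (UNIV :: 'a set) \<times> A" for A :: "'a set" by auto
  show "distr \<Gamma> borel fst = \<mu>"
    using \<Gamma> meas by (intro measure_eqI)
      (auto simp: emeasure_distr vim couplings_def emeasure_eq_measure M.emeasure_eq_measure sets_finite_borel_measures[OF \<mu>])
  show "distr \<Gamma> borel snd = \<nu>"
    using \<Gamma> meas by (intro measure_eqI)
      (auto simp: emeasure_distr vim couplings_def emeasure_eq_measure N.emeasure_eq_measure sets_finite_borel_measures[OF \<nu>])
qed

text \<open>The finite first moments make the infimum over plans finite. This matters for the lower bound on the
  distance, because \<open>enn2real\<close> sends \<open>\<infinity>\<close> to zero.\<close>

lemma coupling_cost_finite:
  fixes \<Gamma> :: "('a::{metric_space, second_countable_topology} \<times> 'a) measure"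
  assumes \<Gamma>: "\<Gamma> \<in> couplings \<mu> \<nu>"
    and \<mu>: "\<mu> \<in> finite_borel_measures_moment 1" and \<nu>: "\<nu> \<in> finite_borel_measures_moment 1"
  shows "(\<integral>\<^sup>+z. ennreal (dist (fst z) (snd z)) \<partial>\<Gamma>) < \<infinity>"
proof -
  have \<Gamma>_fin: "\<Gamma> \<in> finite_borel_measures" using \<Gamma> by (simp add: couplings_def)
  have meas [measurable]: "fst \<in> measurable \<Gamma> (borel :: 'a measure)" "snd \<in> measurable \<Gamma> (borel :: 'a measure)"
    by (simp_all add: measurable_cong_sets[OF sets_finite_borel_measures[OF \<Gamma>_fin] refl] borel_prod[symmetric])
  have marg: "distr \<Gamma> borel fst = \<mu>" "distr \<Gamma> borel snd = \<nu>"
    using coupling_marginals[OF \<Gamma>] \<mu> \<nu> finite_borel_measures_moment_finite by blast+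
  define x0 :: 'a where "x0 = undefined"
  have "(\<integral>\<^sup>+z. ennreal (dist (fst z) (snd z)) \<partial>\<Gamma>)
      \<le> (\<integral>\<^sup>+z. ennreal (dist (fst z) x0) + ennreal (dist (snd z) x0) \<partial>\<Gamma>)"
    by (intro nn_integral_mono) (simp add: ennreal_plus[symmetric] dist_triangle2 del: ennreal_plus)
  also have "\<dots> = (\<integral>\<^sup>+z. ennreal (dist (fst z) x0) \<partial>\<Gamma>) + (\<integral>\<^sup>+z. ennreal (dist (snd z) x0) \<partial>\<Gamma>)"
    by (intro nn_integral_add) simp_all
  also have "\<dots> = (\<integral>\<^sup>+x. ennreal (dist x x0) \<partial>\<mu>) + (\<integral>\<^sup>+x. ennreal (dist x x0) \<partial>\<nu>)"
    unfolding marg[symmetric] by (simp add: nn_integral_distr)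
  also have "\<dots> < \<infinity>"
    using finite_moment_at[OF \<mu>] finite_moment_at[OF \<nu>] by simp
  finally show ?thesis .
qed

lemma ennreal_integral_le_nn_integral:
  fixes h :: "'b \<Rightarrow> real"
  assumes "integrable M h" "\<And>x. h x \<le> d x"
  shows "ennreal (\<integral>x. h x \<partial>M) \<le> (\<integral>\<^sup>+x. ennreal (d x) \<partial>M)"
proof -
  have "ennreal (\<integral>x. h x \<partial>M) \<le> ennreal (\<integral>x. max 0 (h x) \<partial>M)"
    using assms(1) by (intro ennreal_leI integral_mono integrable_max) auto
  also have "\<dots> = (\<integral>\<^sup>+x. ennreal (max 0 (h x)) \<partial>M)"
    using assms(1) by (intro nn_integral_eq_integral[symmetric] integrable_max) auto
  also have "\<dots> \<le> (\<integral>\<^sup>+x. ennreal (d x) \<partial>M)"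
    using assms(2) by (intro nn_integral_mono) (simp add: max_def ennreal_leI)
  finally show ?thesis .
qed

text \<open>Integrating \<open>g1 x + g2 y \<le> b d(x, y)\<close> against a plan gives the inequality for that
  plan. The product coupling shows that the infimum over all plans is finite, so it survives the passage from
  \<open>ennreal\<close> to \<open>real\<close>.\<close>

lemma kantorovich_le_wasserstein:
  fixes \<mu> \<nu> :: "'a::{metric_space, second_countable_topology} measure" and g1 g2 :: "'a \<Rightarrow> real"
  assumes \<mu>m: "\<mu> \<in> finite_borel_measures_moment 1" and \<nu>m: "\<nu> \<in> finite_borel_measures_moment 1"
    and mass: "mass \<mu> = mass \<nu>" and b: "0 < b"
    and g: "g1 \<in> borel_measurable borel" "g2 \<in> borel_measurable borel"
    and bound: "\<And>x. \<bar>g1 x\<bar> \<le> c" "\<And>x. \<bar>g2 x\<bar> \<le> c"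
    and cost: "\<And>x y. g1 x + g2 y \<le> b * dist x y"
  shows "(\<integral>x. g1 x \<partial>\<mu>) + (\<integral>x. g2 x \<partial>\<nu>) \<le> b * wasserstein 1 \<mu> \<nu>"
proof -
  note \<mu> = finite_borel_measures_moment_finite[OF \<mu>m]
  note \<nu> = finite_borel_measures_moment_finite[OF \<nu>m]
  define K where "K = ((\<integral>x. g1 x \<partial>\<mu>) + (\<integral>x. g2 x \<partial>\<nu>)) / b"
  define V where "V = (INF \<pi> \<in> transport_plans \<mu> \<nu>. \<integral>\<^sup>+z. ennreal (dist (fst z) (snd z)) \<partial>\<pi>)"
  have W: "wasserstein 1 \<mu> \<nu> = enn2real (ennreal (mass \<mu>) * V)"
    by (simp add: wasserstein_1 V_def)
  have le: "ennreal K \<le> ennreal (mass \<mu>) * V"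
  proof (cases "mass \<mu> = 0")
    case True
    interpret M: finite_measure \<mu> using \<mu> by (rule finite_borel_measures_finite)
    interpret N: finite_measure \<nu> using \<nu> by (rule finite_borel_measures_finite)
    have "emeasure \<mu> (space \<mu>) = 0" "emeasure \<nu> (space \<nu>) = 0"
      using True mass by (simp_all add: mass_def M.emeasure_eq_measure N.emeasure_eq_measure)
    then have "(\<integral>x. g1 x \<partial>\<mu>) = 0" "(\<integral>x. g2 x \<partial>\<nu>) = 0"
      by (intro integral_eq_zero_AE AE_I[where N = "space \<mu>"] AE_I[where N = "space \<nu>"]; simp)+
    then show ?thesis by (simp add: K_def)
  next
    case False
    then have pos: "0 < mass \<mu>" using mass_nonneg[of \<mu>] by simp
    have "ennreal (K / mass \<mu>) \<le> (\<integral>\<^sup>+z. ennreal (dist (fst z) (snd z)) \<partial>\<pi>)"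
      if \<pi>: "\<pi> \<in> transport_plans \<mu> \<nu>" for \<pi>
    proof -
      have \<pi>_fin: "\<pi> \<in> finite_borel_measures"
        using \<pi> by (auto simp: transport_plans_def finite_borel_measures_def prob_space.finite_measure)
      have comp: "(\<lambda>z :: 'a \<times> 'a. g1 (fst z)) \<in> borel_measurable borel"
          "(\<lambda>z :: 'a \<times> 'a. g2 (snd z)) \<in> borel_measurable borel"
        using measurable_compose[OF measurable_fst g(1)] measurable_compose[OF measurable_snd g(2)]
        unfolding borel_prod[symmetric] by blast+
      have int: "integrable \<pi> (\<lambda>z. g1 (fst z))" "integrable \<pi> (\<lambda>z. g2 (snd z))"
        by (rule integrable_bounded_borel[OF \<pi>_fin comp(1) bound(1)] integrable_bounded_borel[OF \<pi>_fin comp(2) bound(2)])+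
      have "K / mass \<mu> = (mass \<mu> * ((\<integral>z. g1 (fst z) \<partial>\<pi>) + (\<integral>z. g2 (snd z) \<partial>\<pi>))) / b / mass \<mu>"
        unfolding K_def transport_plan_integral_fst[OF \<mu> \<pi> g(1)] transport_plan_integral_snd[OF \<nu> \<pi> g(2)]
          mass[symmetric] distrib_left ..
      also have "\<dots> = (\<integral>z. (g1 (fst z) + g2 (snd z)) / b \<partial>\<pi>)"
        using int pos by simp
      also have "ennreal \<dots> \<le> (\<integral>\<^sup>+z. ennreal (dist (fst z) (snd z)) \<partial>\<pi>)"
        using int cost b by (intro ennreal_integral_le_nn_integral) (auto simp: field_simps)
      finally show ?thesis .
    qed
    then have "ennreal (K / mass \<mu>) \<le> V" unfolding V_def by (rule INF_greatest)
    then have "ennreal (mass \<mu>) * ennreal (K / mass \<mu>) \<le> ennreal (mass \<mu>) * V"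
      by (rule mult_left_mono) simp
    then show ?thesis using pos by (simp add: ennreal_mult'[symmetric])
  qed
  have "ennreal (mass \<mu>) * V < \<infinity>"
  proof (cases "mass \<mu> = 0")
    case False
    then have pos: "0 < mass \<mu>" using mass_nonneg[of \<mu>] by simp
    note C = product_coupling[OF \<mu> \<nu> mass pos]
    from scaled_plan_cost_le_coupling_cost[OF C \<mu> \<nu>] coupling_cost_finite[OF C \<mu>m \<nu>m]
    show ?thesis unfolding V_def by (rule le_less_trans)
  qed simp
  with le have "enn2real (ennreal K) \<le> wasserstein 1 \<mu> \<nu>"
    unfolding W by (intro enn2real_mono) (simp_all add: less_top)
  then have "K \<le> wasserstein 1 \<mu> \<nu>"
    using wasserstein_nonneg[of 1 \<mu> \<nu>] by (cases "0 \<le> K") auto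
  then show ?thesis using b by (simp add: K_def field_simps)
qed

lemma gen_wasserstein_le:
  assumes "0 \<le> a" "0 \<le> b" "\<mu> \<in> finite_borel_measures" "\<nu> \<in> finite_borel_measures"
    and "\<mu>' \<in> finite_borel_measures_moment p" "\<nu>' \<in> finite_borel_measures_moment p" "mass \<mu>' = mass \<nu>'"
  shows "gen_wasserstein a b p \<mu> \<nu>
    \<le> a * tv_mass_diff \<mu> \<mu>' + a * tv_mass_diff \<nu> \<nu>' + b * wasserstein p \<mu>' \<nu>'"
proof -
  have "bdd_below ((\<lambda>(\<mu>', \<nu>'). a * tv_mass_diff \<mu> \<mu>' + a * tv_mass_diff \<nu> \<nu>' + b * wasserstein p \<mu>' \<nu>') `
     {(\<mu>', \<nu>'). \<mu>' \<in> finite_borel_measures_moment p \<and> \<nu>' \<in> finite_borel_measures_moment p \<and> mass \<mu>' = mass \<nu>'})"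
    using assms(1-4)
    by (intro bdd_belowI2[of _ 0])
      (auto intro!: add_nonneg_nonneg mult_nonneg_nonneg tv_mass_diff_nonneg wasserstein_nonneg
        dest: finite_borel_measures_moment_finite)
  from cINF_lower[OF this, of "(\<mu>', \<nu>')"] assms(5-7) show ?thesis
    by (simp add: gen_wasserstein_def)
qed

text \<open>For each admissible pair \<open>(\<mu>', \<nu>')\<close>, replacing \<open>\<mu>1\<close> by
  \<open>\<mu>'\<close> changes the integral of \<open>g1\<close> by at most \<open>a\<close> times the total
  variation, likewise for \<open>\<mu>2\<close>, and what remains is bounded by the transport cost.\<close>

lemma gen_wasserstein_ge_dual:
  fixes \<mu>1 \<mu>2 :: "'a::{metric_space, second_countable_topology} measure"
  assumes "0 \<le> a" and b: "0 < b"
    and \<mu>1: "\<mu>1 \<in> finite_borel_measures" and \<mu>2: "\<mu>2 \<in> finite_borel_measures"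
    and g: "g1 \<in> borel_measurable borel" "g2 \<in> borel_measurable borel"
    and bound: "\<And>x. \<bar>g1 x\<bar> \<le> a" "\<And>x. \<bar>g2 x\<bar> \<le> a"
    and cost: "\<And>x y. g1 x + g2 y \<le> b * dist x y"
  shows "(\<integral>x. g1 x \<partial>\<mu>1) + (\<integral>x. g2 x \<partial>\<mu>2) \<le> gen_wasserstein a b 1 \<mu>1 \<mu>2"
  unfolding gen_wasserstein_def
proof (rule cINF_greatest)
  have "null_measure borel \<in> (finite_borel_measures_moment 1 :: 'a measure set)"
    by (auto simp: finite_borel_measures_moment_def finite_borel_measures_def intro!: finite_measureI)
  then have "(null_measure borel, null_measure borel) \<in> {(\<mu>', \<nu>'). \<mu>' \<in> finite_borel_measures_moment 1 \<and>
      \<nu>' \<in> finite_borel_measures_moment 1 \<and> mass (\<mu>' :: 'a measure) = mass (\<nu>' :: 'a measure)}"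
    by simp
  then show "{(\<mu>', \<nu>'). \<mu>' \<in> finite_borel_measures_moment 1 \<and>
      \<nu>' \<in> finite_borel_measures_moment 1 \<and> mass (\<mu>' :: 'a measure) = mass (\<nu>' :: 'a measure)} \<noteq> {}"
    by (rule ex_in_conv[THEN iffD1, OF exI])
next
  fix z :: "'a measure \<times> 'a measure"
  assume "z \<in> {(\<mu>', \<nu>'). \<mu>' \<in> finite_borel_measures_moment 1 \<and>
      \<nu>' \<in> finite_borel_measures_moment 1 \<and> mass \<mu>' = mass \<nu>'}"
  then obtain \<mu>' \<nu>' where z: "z = (\<mu>', \<nu>')" and m: "\<mu>' \<in> finite_borel_measures_moment 1"
    "\<nu>' \<in> finite_borel_measures_moment 1" "mass \<mu>' = mass \<nu>'" by blast
  have "(\<integral>x. g1 x \<partial>\<mu>1) - (\<integral>x. g1 x \<partial>\<mu>') \<le> a * tv_mass_diff \<mu>1 \<mu>'"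
    "(\<integral>x. g2 x \<partial>\<mu>2) - (\<integral>x. g2 x \<partial>\<nu>') \<le> a * tv_mass_diff \<mu>2 \<nu>'"
    by (intro integral_diff_le_tv_mass_diff \<mu>1 \<mu>2 g bound
        finite_borel_measures_moment_finite[OF m(1)] finite_borel_measures_moment_finite[OF m(2)])+
  moreover have "(\<integral>x. g1 x \<partial>\<mu>') + (\<integral>x. g2 x \<partial>\<nu>') \<le> b * wasserstein 1 \<mu>' \<nu>'"
    using kantorovich_le_wasserstein[OF m b g bound cost] .
  ultimately show "(\<integral>x. g1 x \<partial>\<mu>1) + (\<integral>x. g2 x \<partial>\<mu>2)
      \<le> (case z of (\<mu>', \<nu>') \<Rightarrow> a * tv_mass_diff \<mu>1 \<mu>' + a * tv_mass_diff \<mu>2 \<nu>' + b * wasserstein 1 \<mu>' \<nu>')"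
    by (simp add: z)
qed

section \<open>Generalized distance and partial couplings\<close>

lemma wasserstein_le_coupling_cost:
  assumes "\<Gamma> \<in> couplings \<mu> \<nu>" "\<mu> \<in> finite_borel_measures" "\<nu> \<in> finite_borel_measures"
    and "(\<integral>\<^sup>+z. ennreal (dist (fst z) (snd z)) \<partial>\<Gamma>) \<le> ennreal C" "0 \<le> C"
  shows "wasserstein 1 \<mu> \<nu> \<le> C"
  unfolding wasserstein_1
  using scaled_plan_cost_le_coupling_cost[OF assms(1-3)] assms(4,5)
  by (intro enn2real_leI) (auto intro: order_trans)

text \<open>The marginals of \<open>\<Gamma>\<close> serve as the intermediate measures. Since they lie below
  \<open>\<mu>1\<close> and \<open>\<mu>2\<close>, the total variation terms are just the masses left
  untransported. Hence each unit of transported mass saves \<open>2 a\<close> and costs \<open>b\<close> times the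
  distance, which is the origin of the rewards \<open>2 a - b d\<close> in the linear program.\<close>

lemma gen_wasserstein_le_partial_coupling:
  fixes \<mu>1 \<mu>2 :: "'a::{metric_space, second_countable_topology} measure"
    and \<Gamma> :: "('a \<times> 'a) measure"
  assumes a: "0 \<le> a" and b: "0 \<le> b"
    and \<mu>1: "\<mu>1 \<in> finite_borel_measures" and \<mu>2: "\<mu>2 \<in> finite_borel_measures"
    and \<Gamma>: "\<Gamma> \<in> finite_borel_measures"
    and le1: "\<And>A. A \<in> sets borel \<Longrightarrow> measure \<Gamma> (A \<times> UNIV) \<le> measure \<mu>1 A"
    and le2: "\<And>B. B \<in> sets borel \<Longrightarrow> measure \<Gamma> (UNIV \<times> B) \<le> measure \<mu>2 B"
    and moment: "(\<integral>\<^sup>+z. ennreal (dist (fst z) x0) \<partial>\<Gamma>) < \<infinity>" "(\<integral>\<^sup>+z. ennreal (dist (snd z) x0) \<partial>\<Gamma>) < \<infinity>"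
    and cost: "(\<integral>\<^sup>+z. ennreal (dist (fst z) (snd z)) \<partial>\<Gamma>) \<le> ennreal C" "0 \<le> C"
  shows "gen_wasserstein a b 1 \<mu>1 \<mu>2 \<le> a * (mass \<mu>1 + mass \<mu>2 - 2 * mass \<Gamma>) + b * C"
proof -
  interpret finite_measure \<Gamma> using \<Gamma> by (rule finite_borel_measures_finite)
  have [simp]: "space \<Gamma> = UNIV" using \<Gamma> by (rule space_finite_borel_measures)
  have meas [measurable]: "fst \<in> measurable \<Gamma> (borel :: 'a measure)" "snd \<in> measurable \<Gamma> (borel :: 'a measure)"
    by (simp_all add: measurable_cong_sets[OF sets_finite_borel_measures[OF \<Gamma>] refl] borel_prod[symmetric])
  have vim: "fst -` A = A \<times> (UNIV :: 'a set)" "snd -` A = (UNIV :: 'a set) \<times> A" for A :: "'a set" by auto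
  define \<nu>1 where "\<nu>1 = distr \<Gamma> borel fst"
  define \<nu>2 where "\<nu>2 = distr \<Gamma> borel snd"
  have \<nu>: "\<nu>1 \<in> finite_borel_measures" "\<nu>2 \<in> finite_borel_measures"
    using finite_measure_distr[OF meas(1)] finite_measure_distr[OF meas(2)]
    by (simp_all add: \<nu>1_def \<nu>2_def finite_borel_measures_def)
  have m: "measure \<nu>1 A = measure \<Gamma> (A \<times> UNIV)" "measure \<nu>2 A = measure \<Gamma> (UNIV \<times> A)"
    if "A \<in> sets borel" for A
    using that meas by (simp_all add: \<nu>1_def \<nu>2_def measure_distr vim)
  have mass: "mass \<nu>1 = mass \<Gamma>" "mass \<nu>2 = mass \<Gamma>"
    using m[of UNIV] \<nu> by (simp_all add: mass_finite_borel_measures \<Gamma>)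
  have moments: "\<nu>1 \<in> finite_borel_measures_moment 1" "\<nu>2 \<in> finite_borel_measures_moment 1"
    using \<nu> moment unfolding finite_borel_measures_moment_def
    by (auto simp: \<nu>1_def \<nu>2_def nn_integral_distr intro!: exI[of _ x0])
  have "\<Gamma> \<in> couplings \<nu>1 \<nu>2" using \<Gamma> m by (simp add: couplings_def)
  then have W: "wasserstein 1 \<nu>1 \<nu>2 \<le> C"
    using \<nu> cost by (rule wasserstein_le_coupling_cost)
  have tv: "tv_mass_diff \<mu>1 \<nu>1 \<le> mass \<mu>1 - mass \<Gamma>" "tv_mass_diff \<mu>2 \<nu>2 \<le> mass \<mu>2 - mass \<Gamma>"
    using tv_mass_diff_dominated[OF \<mu>1 \<nu>(1)] tv_mass_diff_dominated[OF \<mu>2 \<nu>(2)]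
    by (simp_all add: m le1 le2 mass)
  have "gen_wasserstein a b 1 \<mu>1 \<mu>2
      \<le> a * tv_mass_diff \<mu>1 \<nu>1 + a * tv_mass_diff \<mu>2 \<nu>2 + b * wasserstein 1 \<nu>1 \<nu>2"
    using a b \<mu>1 \<mu>2 moments by (rule gen_wasserstein_le) (simp add: mass)
  also have "\<dots> \<le> a * (mass \<mu>1 - mass \<Gamma>) + a * (mass \<mu>2 - mass \<Gamma>) + b * C"
    by (intro add_mono mult_left_mono tv W a b)
  finally show ?thesis by (simp add: algebra_simps)
qed

section \<open>Discretization\<close>

text \<open>Disjointed balls around a countable dense set exhaust the space, so finitely many of them carry all but
  \<open>\<epsilon>\<close> of both masses.\<close>

lemma exists_small_cells:
  fixes \<mu>1 \<mu>2 :: "'a::{metric_space, second_countable_topology} measure"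
  assumes \<mu>1: "\<mu>1 \<in> finite_borel_measures" and \<mu>2: "\<mu>2 \<in> finite_borel_measures" and \<epsilon>: "0 < \<epsilon>"
  obtains N :: nat and x :: "nat \<Rightarrow> 'a" and A :: "nat \<Rightarrow> 'a set"
  where "\<And>k. A k \<in> sets borel" "disjoint_family A" "\<And>k y. y \<in> A k \<Longrightarrow> dist y (x k) < \<epsilon>"
    "mass \<mu>1 - \<epsilon> < (\<Sum>k<N. measure \<mu>1 (A k))" "mass \<mu>2 - \<epsilon> < (\<Sum>k<N. measure \<mu>2 (A k))"
proof -
  obtain D :: "'a set" where D: "countable D" "\<And>X. open X \<Longrightarrow> X \<noteq> {} \<Longrightarrow> \<exists>d\<in>D. d \<in> X"
    using countable_dense_setE by blast
  have "D \<noteq> {}" using D(2)[of UNIV] by auto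
  define x where "x = from_nat_into D"
  define A where "A = disjointed (\<lambda>k. ball (x k) \<epsilon>)"
  have A_borel: "A k \<in> sets borel" for k
  proof -
    have "range A \<subseteq> sets borel"
      unfolding A_def by (rule sets.range_disjointed_sets) auto
    then show ?thesis by blast
  qed
  have disj: "disjoint_family A" unfolding A_def by (rule disjoint_family_disjointed)
  have cover: "(\<Union>k. A k) = UNIV"
  proof -
    have "\<exists>k. y \<in> ball (x k) \<epsilon>" for y
    proof -
      obtain d where d: "d \<in> D" "d \<in> ball y \<epsilon>" using D(2)[of "ball y \<epsilon>"] \<epsilon> by auto
      then obtain k where "x k = d" using from_nat_into_surj[OF D(1)] by (auto simp: x_def)
      with d show ?thesis by (auto simp: dist_commute)
    qed
    then show ?thesis unfolding A_def UN_disjointed_eq by blast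
  qed
  have ev: "eventually (\<lambda>N. mass \<mu> - \<epsilon> < (\<Sum>k<N. measure \<mu> (A k))) sequentially"
    if \<mu>: "\<mu> \<in> finite_borel_measures" for \<mu>
  proof -
    interpret finite_measure \<mu> using \<mu> by (rule finite_borel_measures_finite)
    have "(\<lambda>k. measure \<mu> (A k)) sums measure \<mu> (\<Union>k. A k)"
      using A_borel disj by (intro finite_measure_UNION) (auto simp: sets_finite_borel_measures[OF \<mu>])
    then have "(\<lambda>N. \<Sum>k<N. measure \<mu> (A k)) \<longlonglongrightarrow> mass \<mu>"
      by (simp add: sums_def cover mass_finite_borel_measures[OF \<mu>])
    then show ?thesis by (rule order_tendstoD) (use \<epsilon> in simp)
  qed
  have "eventually (\<lambda>N. mass \<mu>1 - \<epsilon> < (\<Sum>k<N. measure \<mu>1 (A k)) \<and>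
      mass \<mu>2 - \<epsilon> < (\<Sum>k<N. measure \<mu>2 (A k))) sequentially"
    using ev[OF \<mu>1] ev[OF \<mu>2] by (rule eventually_conj)
  then obtain N where "mass \<mu>1 - \<epsilon> < (\<Sum>k<N. measure \<mu>1 (A k))"
    "mass \<mu>2 - \<epsilon> < (\<Sum>k<N. measure \<mu>2 (A k))"
    by (auto simp: eventually_sequentially)
  moreover have "dist y (x k) < \<epsilon>" if "y \<in> A k" for k y
    using that disjointed_subset[of "\<lambda>k. ball (x k) \<epsilon>" k] by (auto simp: A_def dist_commute)
  ultimately show ?thesis using A_borel disj by (intro that) auto
qed

lemma sum_measure_Int_disjoint_le:
  fixes A :: "nat \<Rightarrow> 'a::topological_space set"
  assumes \<mu>: "\<mu> \<in> finite_borel_measures"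
    and A: "\<And>k. A k \<in> sets borel" "disjoint_family A" and B: "B \<in> sets borel"
  shows "(\<Sum>k<N. measure \<mu> (B \<inter> A k)) \<le> measure \<mu> B"
proof -
  interpret finite_measure \<mu> using \<mu> by (rule finite_borel_measures_finite)
  have "(\<Sum>k<N. measure \<mu> (B \<inter> A k)) = measure \<mu> (\<Union>k<N. B \<inter> A k)"
    using A B by (intro finite_measure_finite_Union[symmetric])
      (auto simp: sets_finite_borel_measures[OF \<mu>] disjoint_family_on_def)
  also have "\<dots> \<le> measure \<mu> B"
    using B by (intro finite_measure_mono) (auto simp: sets_finite_borel_measures[OF \<mu>])
  finally show ?thesis .
qed

lemma double_sum_ennreal:
  assumes "\<And>j k. j \<in> J \<Longrightarrow> k \<in> K \<Longrightarrow> 0 \<le> g j k"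
  shows "(\<Sum>j\<in>J. \<Sum>k\<in>K. ennreal (g j k)) = ennreal (\<Sum>j\<in>J. \<Sum>k\<in>K. g j k)"
proof -
  have "(\<Sum>j\<in>J. \<Sum>k\<in>K. ennreal (g j k)) = (\<Sum>j\<in>J. ennreal (\<Sum>k\<in>K. g j k))"
    using assms by (intro sum.cong sum_ennreal) auto
  also have "\<dots> = ennreal (\<Sum>j\<in>J. \<Sum>k\<in>K. g j k)"
    using assms by (intro sum_ennreal sum_nonneg) auto
  finally show ?thesis .
qed

text \<open>A discrete plan \<open>\<pi>\<close> between cell masses is spread out proportionally to the product
  measure: on \<open>A j \<times> A k\<close> the density is \<open>\<pi> j k / (m1 j * m2 k)\<close>. Cells of
  mass zero cause no trouble: there \<open>\<pi> j k = 0\<close> by the marginal bounds, which agrees with division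
  by zero. The marginals then have densities at most one with respect to \<open>\<mu>1\<close> and
  \<open>\<mu>2\<close>. The last conclusion bounds integrals over \<open>\<Gamma>\<close> by discrete sums; it is
  used for the cost and for the first moments.\<close>

lemma cellwise_coupling:
  fixes \<mu>1 \<mu>2 :: "'a::{metric_space, second_countable_topology} measure"
    and A :: "nat \<Rightarrow> 'a set" and \<pi> :: "nat \<Rightarrow> nat \<Rightarrow> real"
  assumes \<mu>1: "\<mu>1 \<in> finite_borel_measures" and \<mu>2: "\<mu>2 \<in> finite_borel_measures"
    and A: "\<And>k. A k \<in> sets borel" "disjoint_family A"
    and \<pi>: "\<And>j k. j < N \<Longrightarrow> k < N \<Longrightarrow> 0 \<le> \<pi> j k"
    and row: "\<And>j. j < N \<Longrightarrow> (\<Sum>k<N. \<pi> j k) \<le> measure \<mu>1 (A j)"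
    and col: "\<And>k. k < N \<Longrightarrow> (\<Sum>j<N. \<pi> j k) \<le> measure \<mu>2 (A k)"
  obtains \<Gamma> where "\<Gamma> \<in> finite_borel_measures"
    "\<And>B. B \<in> sets borel \<Longrightarrow> measure \<Gamma> (B \<times> UNIV) \<le> measure \<mu>1 B"
    "\<And>B. B \<in> sets borel \<Longrightarrow> measure \<Gamma> (UNIV \<times> B) \<le> measure \<mu>2 B"
    "mass \<Gamma> = (\<Sum>j<N. \<Sum>k<N. \<pi> j k)"
    "\<And>f F. f \<in> borel_measurable borel \<Longrightarrow> (\<And>j k. 0 \<le> F j k) \<Longrightarrow>
      (\<And>j k y z. y \<in> A j \<Longrightarrow> z \<in> A k \<Longrightarrow> f (y, z) \<le> F j k) \<Longrightarrow>
      (\<integral>\<^sup>+z. ennreal (f z) \<partial>\<Gamma>) \<le> ennreal (\<Sum>j<N. \<Sum>k<N. \<pi> j k * F j k)"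
proof -
  interpret M1: finite_measure \<mu>1 using \<mu>1 by (rule finite_borel_measures_finite)
  interpret M2: finite_measure \<mu>2 using \<mu>2 by (rule finite_borel_measures_finite)
  define P where "P = \<mu>1 \<Otimes>\<^sub>M \<mu>2"
  interpret P: finite_measure P
    unfolding P_def by (intro finite_measure_pair_measure M1.finite_measure_axioms M2.finite_measure_axioms)
  have sets_P: "sets P = sets borel"
    unfolding P_def borel_prod[symmetric]
    by (intro sets_pair_measure_cong sets_finite_borel_measures \<mu>1 \<mu>2)
  have space_P: "space P = UNIV" using sets_eq_imp_space_eq[OF sets_P] by simp
  have P_Times: "measure P (B \<times> C) = measure \<mu>1 B * measure \<mu>2 C" if "B \<in> sets borel" "C \<in> sets borel" for B C
    unfolding P_def using that \<mu>1 \<mu>2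
    by (intro measure_pair_measure_Times_finite) (simp_all add: sets_finite_borel_measures finite_borel_measures_finite)
  have rect: "B \<times> C \<in> sets P" if "B \<in> sets borel" "C \<in> sets borel" for B C
    using that unfolding sets_P by (simp add: borel_prod[symmetric])
  define m1 where "m1 j = measure \<mu>1 (A j)" for j
  define m2 where "m2 k = measure \<mu>2 (A k)" for k
  have m_nonneg: "0 \<le> m1 j" "0 \<le> m2 k" for j k by (simp_all add: m1_def m2_def)
  have \<pi>_le: "\<pi> j k \<le> m1 j" "\<pi> j k \<le> m2 k" if "j < N" "k < N" for j k
  proof -
    have "\<pi> j k \<le> (\<Sum>k<N. \<pi> j k)" "\<pi> j k \<le> (\<Sum>j<N. \<pi> j k)"
      using that \<pi> by (intro member_le_sum; simp)+
    then show "\<pi> j k \<le> m1 j" "\<pi> j k \<le> m2 k"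
      using row[OF that(1)] col[OF that(2)] by (simp_all add: m1_def m2_def)
  qed
  define w where "w j k = \<pi> j k / (m1 j * m2 k)" for j k
  have w_nonneg: "0 \<le> w j k" if "j < N" "k < N" for j k
    using \<pi>[OF that] m_nonneg by (simp add: w_def)
  have w1: "w j k * m1 j = \<pi> j k / m2 k" and w2: "w j k * m2 k = \<pi> j k / m1 j"
    and w12: "w j k * (m1 j * m2 k) = \<pi> j k" if "j < N" "k < N" for j k
    using \<pi>_le[OF that] \<pi>[OF that] by (auto simp: w_def)
  define h where "h z = (\<Sum>j<N. \<Sum>k<N. ennreal (w j k) * indicator (A j \<times> A k) z)" for z
  have h_meas: "h \<in> borel_measurable P"
    unfolding h_def by (intro borel_measurable_sum borel_measurable_times_ennreal borel_measurable_indicator rect A) simp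
  define \<Gamma> where "\<Gamma> = density P h"
  have int_\<Gamma>: "(\<integral>\<^sup>+z. f z \<partial>\<Gamma>) = (\<Sum>j<N. \<Sum>k<N. ennreal (w j k) * (\<integral>\<^sup>+z. f z * indicator (A j \<times> A k) z \<partial>P))"
    if f: "f \<in> borel_measurable P" for f
  proof -
    have ind: "(\<lambda>z. f z * indicator (A j \<times> A k) z) \<in> borel_measurable P" for j k
      by (intro borel_measurable_times_ennreal borel_measurable_indicator rect A f)
    have "(\<integral>\<^sup>+z. f z \<partial>\<Gamma>) = (\<integral>\<^sup>+z. h z * f z \<partial>P)"
      unfolding \<Gamma>_def using h_meas f by (rule nn_integral_density)
    also have "\<dots> = (\<integral>\<^sup>+z. (\<Sum>j<N. \<Sum>k<N. ennreal (w j k) * (f z * indicator (A j \<times> A k) z)) \<partial>P)"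
      unfolding h_def by (simp only: sum_distrib_left sum_distrib_right mult_ac)
    also have "\<dots> = (\<Sum>j<N. \<Sum>k<N. \<integral>\<^sup>+z. ennreal (w j k) * (f z * indicator (A j \<times> A k) z) \<partial>P)"
      using ind by (subst nn_integral_sum, simp, subst nn_integral_sum) simp_all
    also have "\<dots> = (\<Sum>j<N. \<Sum>k<N. ennreal (w j k) * (\<integral>\<^sup>+z. f z * indicator (A j \<times> A k) z \<partial>P))"
      using ind by (simp add: nn_integral_cmult)
    finally show ?thesis .
  qed
  have e\<Gamma>: "emeasure \<Gamma> (B \<times> C) = ennreal (\<Sum>j<N. \<Sum>k<N. w j k * (measure \<mu>1 (B \<inter> A j) * measure \<mu>2 (C \<inter> A k)))"
    if B: "B \<in> sets borel" and C: "C \<in> sets borel" for B C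
  proof -
    have "emeasure \<Gamma> (B \<times> C) = (\<integral>\<^sup>+z. indicator (B \<times> C) z \<partial>\<Gamma>)"
      using rect[OF B C] by (simp add: \<Gamma>_def)
    also have "\<dots> = (\<Sum>j<N. \<Sum>k<N. ennreal (w j k) *
        (\<integral>\<^sup>+z. indicator (B \<times> C) z * indicator (A j \<times> A k) z \<partial>P))"
      by (rule int_\<Gamma>) (intro borel_measurable_indicator rect B C)
    also have "\<dots> = (\<Sum>j<N. \<Sum>k<N. ennreal (w j k * (measure \<mu>1 (B \<inter> A j) * measure \<mu>2 (C \<inter> A k))))"
    proof (intro sum.cong refl)
      fix j k assume jk: "j \<in> {..<N}" "k \<in> {..<N}"
      have "(\<integral>\<^sup>+z. indicator (B \<times> C) z * indicator (A j \<times> A k) z \<partial>P)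
          = (\<integral>\<^sup>+z. indicator ((B \<inter> A j) \<times> (C \<inter> A k)) z \<partial>P)"
        by (intro nn_integral_cong) (auto simp: indicator_def)
      also have "\<dots> = emeasure P ((B \<inter> A j) \<times> (C \<inter> A k))"
        using A B C by (intro nn_integral_indicator rect) auto
      also have "\<dots> = ennreal (measure \<mu>1 (B \<inter> A j) * measure \<mu>2 (C \<inter> A k))"
        using A B C by (simp add: P.emeasure_eq_measure P_Times)
      finally show "ennreal (w j k) * (\<integral>\<^sup>+z. indicator (B \<times> C) z * indicator (A j \<times> A k) z \<partial>P)
          = ennreal (w j k * (measure \<mu>1 (B \<inter> A j) * measure \<mu>2 (C \<inter> A k)))"
        using w_nonneg jk by (simp add: ennreal_mult)
    qed
    also have "\<dots> = ennreal (\<Sum>j<N. \<Sum>k<N. w j k * (measure \<mu>1 (B \<inter> A j) * measure \<mu>2 (C \<inter> A k)))"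
      using w_nonneg by (intro double_sum_ennreal) simp
    finally show ?thesis .
  qed
  have m\<Gamma>: "measure \<Gamma> (B \<times> C) = (\<Sum>j<N. \<Sum>k<N. w j k * (measure \<mu>1 (B \<inter> A j) * measure \<mu>2 (C \<inter> A k)))"
    if "B \<in> sets borel" "C \<in> sets borel" for B C
    unfolding measure_def[of \<Gamma>] e\<Gamma>[OF that]
    using w_nonneg by (intro enn2real_ennreal sum_nonneg mult_nonneg_nonneg) auto
  have \<Gamma>_fin: "\<Gamma> \<in> finite_borel_measures"
    using e\<Gamma>[of UNIV UNIV]
    by (auto simp: finite_borel_measures_def \<Gamma>_def sets_P space_P intro!: finite_measureI)
  show thesis
  proof (rule that[OF \<Gamma>_fin])
    fix B :: "'a set" assume B: "B \<in> sets borel"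
    have "measure \<Gamma> (B \<times> UNIV) = (\<Sum>j<N. \<Sum>k<N. measure \<mu>1 (B \<inter> A j) * (w j k * m2 k))"
      by (subst m\<Gamma>[OF B]) (simp_all add: m2_def ac_simps)
    also have "\<dots> = (\<Sum>j<N. \<Sum>k<N. measure \<mu>1 (B \<inter> A j) * (\<pi> j k / m1 j))"
      using w2 by (intro sum.cong refl) simp
    also have "\<dots> = (\<Sum>j<N. measure \<mu>1 (B \<inter> A j) * ((\<Sum>k<N. \<pi> j k) / m1 j))"
      by (simp only: sum_distrib_left sum_divide_distrib)
    also have "\<dots> \<le> (\<Sum>j<N. measure \<mu>1 (B \<inter> A j) * 1)"
      using row m_nonneg by (intro sum_mono mult_left_mono) (auto simp: m1_def divide_le_eq_1 zero_less_measure_iff)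
    also have "\<dots> \<le> measure \<mu>1 B" using sum_measure_Int_disjoint_le[OF \<mu>1 A B] by simp
    finally show "measure \<Gamma> (B \<times> UNIV) \<le> measure \<mu>1 B" .
    have "measure \<Gamma> (UNIV \<times> B) = (\<Sum>j<N. \<Sum>k<N. measure \<mu>2 (B \<inter> A k) * (w j k * m1 j))"
      by (subst m\<Gamma>[OF _ B]) (simp_all add: m1_def ac_simps)
    also have "\<dots> = (\<Sum>j<N. \<Sum>k<N. measure \<mu>2 (B \<inter> A k) * (\<pi> j k / m2 k))"
      using w1 by (intro sum.cong refl) simp
    also have "\<dots> = (\<Sum>k<N. measure \<mu>2 (B \<inter> A k) * ((\<Sum>j<N. \<pi> j k) / m2 k))"
      by (subst sum.swap) (simp only: sum_distrib_left sum_divide_distrib)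
    also have "\<dots> \<le> (\<Sum>k<N. measure \<mu>2 (B \<inter> A k) * 1)"
      using col m_nonneg by (intro sum_mono mult_left_mono) (auto simp: m2_def divide_le_eq_1 zero_less_measure_iff)
    also have "\<dots> \<le> measure \<mu>2 B" using sum_measure_Int_disjoint_le[OF \<mu>2 A B] by simp
    finally show "measure \<Gamma> (UNIV \<times> B) \<le> measure \<mu>2 B" .
  next
    have "mass \<Gamma> = measure \<Gamma> (UNIV \<times> UNIV)" by (simp add: mass_finite_borel_measures[OF \<Gamma>_fin])
    also have "\<dots> = (\<Sum>j<N. \<Sum>k<N. \<pi> j k)"
      using w12 by (subst m\<Gamma>) (simp_all add: m1_def m2_def)
    finally show "mass \<Gamma> = (\<Sum>j<N. \<Sum>k<N. \<pi> j k)" .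
  next
    fix f :: "'a \<times> 'a \<Rightarrow> real" and F :: "nat \<Rightarrow> nat \<Rightarrow> real"
    assume f: "f \<in> borel_measurable borel" and F: "\<And>j k. 0 \<le> F j k"
      "\<And>j k y z. y \<in> A j \<Longrightarrow> z \<in> A k \<Longrightarrow> f (y, z) \<le> F j k"
    have f_meas: "(\<lambda>z. ennreal (f z)) \<in> borel_measurable P"
      using f by (simp add: measurable_cong_sets[OF sets_P refl])
    have "(\<integral>\<^sup>+z. ennreal (f z) \<partial>\<Gamma>) = (\<Sum>j<N. \<Sum>k<N. ennreal (w j k) * (\<integral>\<^sup>+z. ennreal (f z) * indicator (A j \<times> A k) z \<partial>P))"
      using f_meas by (rule int_\<Gamma>)
    also have "\<dots> \<le> (\<Sum>j<N. \<Sum>k<N. ennreal (\<pi> j k * F j k))"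
    proof (intro sum_mono)
      fix j k assume jk: "j \<in> {..<N}" "k \<in> {..<N}"
      have "(\<integral>\<^sup>+z. ennreal (f z) * indicator (A j \<times> A k) z \<partial>P) \<le> (\<integral>\<^sup>+z. ennreal (F j k) * indicator (A j \<times> A k) z \<partial>P)"
        using F(2) by (intro nn_integral_mono) (auto simp: indicator_def intro!: ennreal_leI)
      also have "\<dots> = ennreal (F j k) * emeasure P (A j \<times> A k)"
        by (intro nn_integral_cmult_indicator rect A)
      also have "\<dots> = ennreal (F j k * (m1 j * m2 k))"
        using F(1) A by (simp add: P.emeasure_eq_measure P_Times m1_def m2_def ennreal_mult)
      finally have "ennreal (w j k) * (\<integral>\<^sup>+z. ennreal (f z) * indicator (A j \<times> A k) z \<partial>P)
          \<le> ennreal (w j k) * ennreal (F j k * (m1 j * m2 k))"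
        by (rule mult_left_mono) simp
      also have "\<dots> = ennreal (w j k * (m1 j * m2 k) * F j k)"
        using w_nonneg jk F(1) m_nonneg by (simp add: ennreal_mult[symmetric] ac_simps)
      also have "\<dots> = ennreal (\<pi> j k * F j k)" using w12 jk by simp
      finally show "ennreal (w j k) * (\<integral>\<^sup>+z. ennreal (f z) * indicator (A j \<times> A k) z \<partial>P) \<le> ennreal (\<pi> j k * F j k)" .
    qed
    also have "\<dots> = ennreal (\<Sum>j<N. \<Sum>k<N. \<pi> j k * F j k)"
      using \<pi> F(1) by (intro double_sum_ennreal) simp
    finally show "(\<integral>\<^sup>+z. ennreal (f z) \<partial>\<Gamma>) \<le> ennreal (\<Sum>j<N. \<Sum>k<N. \<pi> j k * F j k)" .
  qed
qed

text \<open>The function \<open>y \<mapsto> min a (min\<^sub>k (b d(y, x k) - q k))\<close> is the c-transform of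
  \<open>q\<close> truncated at \<open>a\<close>. It is \<open>b\<close>-Lipschitz as a minimum of such functions,
  it dominates \<open>p\<close> because \<open>p + q \<le> b d\<close>, and taking \<open>y = x k\<close> shows
  that it is at most \<open>- q k\<close> there. The lower bound \<open>- a\<close> comes from
  \<open>q \<le> a\<close>.\<close>

lemma lipschitz_potential_extension:
  fixes x :: "nat \<Rightarrow> 'a::metric_space" and p q :: "nat \<Rightarrow> real"
  assumes a: "0 \<le> a" and b: "0 \<le> b"
    and p: "\<And>j. j < N \<Longrightarrow> p j \<le> a" and q: "\<And>k. k < N \<Longrightarrow> q k \<le> a"
    and pq: "\<And>j k. j < N \<Longrightarrow> k < N \<Longrightarrow> p j + q k \<le> b * dist (x j) (x k)"
  obtains f :: "'a \<Rightarrow> real" where "\<And>y. \<bar>f y\<bar> \<le> a" "\<And>y z. f y - f z \<le> b * dist y z"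
    "\<And>j. j < N \<Longrightarrow> p j \<le> f (x j)" "\<And>k. k < N \<Longrightarrow> f (x k) \<le> - q k"
proof -
  define S where "S y = insert a ((\<lambda>k. b * dist y (x k) - q k) ` {..<N})" for y
  define f where "f y = Min (S y)" for y
  have S: "finite (S y)" "S y \<noteq> {}" for y by (simp_all add: S_def)
  have f_le: "f y \<le> s" if "s \<in> S y" for y s
    unfolding f_def using S that by (intro Min_le) auto
  have le_f: "c \<le> f y" if "c \<le> a" "\<And>k. k < N \<Longrightarrow> c \<le> b * dist y (x k) - q k" for c y
    unfolding f_def using S that by (subst Min_ge_iff) (auto simp: S_def)
  show ?thesis
  proof (rule that)
    fix y z
    have "- a \<le> b * dist y (x k) - q k" if "k < N" for k
      using q[OF that] mult_nonneg_nonneg[OF b zero_le_dist[of y "x k"]] by linarith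
    then have "- a \<le> f y" using a by (intro le_f) auto
    moreover have "f y \<le> a" by (rule f_le) (simp add: S_def)
    ultimately show "\<bar>f y\<bar> \<le> a" by (simp add: abs_le_iff)
    have "f y - b * dist y z \<le> f z"
    proof (rule le_f)
      show "f y - b * dist y z \<le> a"
        using \<open>f y \<le> a\<close> mult_nonneg_nonneg[OF b zero_le_dist[of y z]] by linarith
      fix k assume "k < N"
      then have "f y \<le> b * dist y (x k) - q k" by (intro f_le) (simp add: S_def)
      also have "b * dist y (x k) \<le> b * (dist y z + dist z (x k))"
        by (intro mult_left_mono dist_triangle b)
      finally show "f y - b * dist y z \<le> b * dist z (x k) - q k"
        by (simp add: distrib_left)
    qed
    then show "f y - f z \<le> b * dist y z" by simp
  next
    fix j assume j: "j < N"
    show "p j \<le> f (x j)"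
    proof (rule le_f)
      show "p j \<le> b * dist (x j) (x k) - q k" if "k < N" for k
        using pq[OF j that] by simp
    qed (rule p[OF j])
  next
    fix k assume k: "k < N"
    have "f (x k) \<le> b * dist (x k) (x k) - q k"
      using k by (intro f_le) (unfold S_def, intro insertI2 imageI, simp)
    then show "f (x k) \<le> - q k" by simp
  qed
qed

lemma one_sided_lipschitz_continuous:
  fixes f :: "'a::metric_space \<Rightarrow> real"
  assumes "0 \<le> b" "\<And>y z. f y - f z \<le> b * dist y z"
  shows "continuous_on UNIV f"
proof -
  have "b-lipschitz_on UNIV f"
  proof (rule lipschitz_onI)
    show "dist (f y) (f z) \<le> b * dist y z" for y z
      using assms(2)[of y z] assms(2)[of z y] by (simp add: dist_real_def abs_le_iff dist_commute)
  qed fact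
  then show ?thesis by (rule lipschitz_on_continuous_on)
qed

lemma integral_ge_cellwise:
  fixes g :: "'a::topological_space \<Rightarrow> real" and A :: "nat \<Rightarrow> 'a set"
  assumes \<mu>: "\<mu> \<in> finite_borel_measures"
    and A: "\<And>k. A k \<in> sets borel" "disjoint_family A"
    and g: "g \<in> borel_measurable borel" and bound: "\<And>y. \<bar>g y\<bar> \<le> a"
    and c: "\<And>k y. k < N \<Longrightarrow> y \<in> A k \<Longrightarrow> c k \<le> g y"
  shows "(\<Sum>k<N. c k * measure \<mu> (A k)) - a * (mass \<mu> - (\<Sum>k<N. measure \<mu> (A k))) \<le> (\<integral>y. g y \<partial>\<mu>)"
proof -
  interpret finite_measure \<mu> using \<mu> by (rule finite_borel_measures_finite)
  have [simp]: "A k \<in> sets \<mu>" "space \<mu> = UNIV" for k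
    using A \<mu> by (simp_all add: sets_finite_borel_measures space_finite_borel_measures)
  have int: "integrable \<mu> (\<lambda>y. (c k + a) * indicator (A k) y :: real)" for k
    by (intro integrable_mult_right integrable_real_indicator) (simp_all add: emeasure_finite less_top[symmetric])
  \<comment> \<open>The comparison function is \<open>c k\<close> on \<open>A k\<close> and \<open>- a\<close> off the cells.\<close>
  have "(\<Sum>k<N. (c k + a) * indicator (A k) y) - a \<le> g y" for y
  proof (cases "\<exists>k<N. y \<in> A k")
    case True
    then obtain k where k: "k < N" "y \<in> A k" by blast
    have "indicator (A j) y = (if j = k then 1 else 0 :: real)" for j
      using k A(2) by (auto simp: disjoint_family_on_def indicator_def)
    then have "(\<Sum>k<N. (c k + a) * indicator (A k) y) = (\<Sum>j<N. if j = k then c k + a else 0)"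
      by (intro sum.cong) simp_all
    also have "\<dots> = c k + a" using k(1) by simp
    finally have "(\<Sum>k<N. (c k + a) * indicator (A k) y) = c k + a" .
    then show ?thesis using c[OF k] by simp
  next
    case False
    then have "(\<Sum>k<N. (c k + a) * indicator (A k) y) = 0"
      by (intro sum.neutral) auto
    then show ?thesis using bound[of y] by linarith
  qed
  then have "(\<integral>y. (\<Sum>k<N. (c k + a) * indicator (A k) y) - a \<partial>\<mu>) \<le> (\<integral>y. g y \<partial>\<mu>)"
    using int by (intro integral_mono integrable_bounded_borel[OF \<mu> g bound]
        Bochner_Integration.integrable_diff Bochner_Integration.integrable_sum) auto
  also have "(\<integral>y. (\<Sum>k<N. (c k + a) * indicator (A k) y) - a \<partial>\<mu>)
      = (\<integral>y. (\<Sum>k<N. (c k + a) * indicator (A k) y) \<partial>\<mu>) - (\<integral>y. a \<partial>\<mu>)"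
    by (intro Bochner_Integration.integral_diff Bochner_Integration.integrable_sum int) simp
  also have "(\<integral>y. (\<Sum>k<N. (c k + a) * indicator (A k) y) \<partial>\<mu>)
      = (\<Sum>k<N. \<integral>y. (c k + a) * indicator (A k) y \<partial>\<mu>)"
    by (intro Bochner_Integration.integral_sum int)
  also have "\<dots> = (\<Sum>k<N. (c k + a) * measure \<mu> (A k))" by simp
  also have "(\<integral>y. a \<partial>\<mu>) = a * mass \<mu>" by (simp add: mass_def)
  finally show ?thesis
    by (simp add: distrib_right sum.distrib sum_distrib_left right_diff_distrib)
qed

section \<open>Strong duality\<close>

text \<open>The potentials are restricted to pairs \<open>(f, - f)\<close> with \<open>f\<close> Lipschitz. At mesh
  \<open>\<epsilon>\<close> the theorem of the alternative is applied to the cell masses with rewards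
  \<open>2 a - b d\<close> and a threshold \<open>\<gamma>\<close> so close to
  \<open>a (\<bar>\<mu>1\<bar> + \<bar>\<mu>2\<bar>) - D\<close> that prices \<open>u, v\<close> would yield,
  through the potentials \<open>a - u\<close> and \<open>a - v\<close>, an \<open>f\<close> whose dual value
  exceeds \<open>D\<close>. So there is a discrete plan earning \<open>\<gamma>\<close>, and spreading it out gives
  a partial coupling of total cost at most \<open>D + O(\<epsilon>)\<close>.\<close>

lemma gen_wasserstein_le_lipschitz_bound:
  fixes \<mu>1 \<mu>2 :: "'a::{metric_space, second_countable_topology} measure"
  assumes a: "0 < a" and b: "0 < b"
    and \<mu>1: "\<mu>1 \<in> finite_borel_measures" and \<mu>2: "\<mu>2 \<in> finite_borel_measures"
    and dual: "\<And>f :: 'a \<Rightarrow> real. (\<And>y. \<bar>f y\<bar> \<le> a) \<Longrightarrow> (\<And>y z. f y - f z \<le> b * dist y z) \<Longrightarrow>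
      (\<integral>y. f y \<partial>\<mu>1) + (\<integral>y. - f y \<partial>\<mu>2) \<le> D"
  shows "gen_wasserstein a b 1 \<mu>1 \<mu>2 \<le> D"
proof (rule le_of_le_add_mult)
  let ?M = "mass \<mu>1 + mass \<mu>2"
  show "0 \<le> 4 * a + b * ?M + 2 * b * mass \<mu>1"
    using a b mass_nonneg[of \<mu>1] mass_nonneg[of \<mu>2] by simp
  fix \<epsilon> :: real assume \<epsilon>: "0 < \<epsilon>"
  obtain N :: nat and x A where A: "\<And>k. A k \<in> sets borel" "disjoint_family A"
    and diam: "\<And>k y. y \<in> A k \<Longrightarrow> dist y (x k) < \<epsilon>"
    and rest: "mass \<mu>1 - \<epsilon> < (\<Sum>k<N. measure \<mu>1 (A k))" "mass \<mu>2 - \<epsilon> < (\<Sum>k<N. measure \<mu>2 (A k))"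
    by (rule exists_small_cells[OF \<mu>1 \<mu>2 \<epsilon>]) (rule that)
  define m1 where "m1 j = measure \<mu>1 (A j)" for j
  define m2 where "m2 k = measure \<mu>2 (A k)" for k
  define d where "d j k = dist (x j) (x k)" for j k
  \<comment> \<open>The correction covers, on the dual side, the uncovered mass (\<open>2 a \<epsilon>\<close> for each measure) and
    the oscillation of \<open>f\<close> on the cells (\<open>b \<epsilon>\<close> per unit of mass).\<close>
  define \<gamma> where "\<gamma> = a * ?M - D - \<epsilon> * (4 * a + b * ?M)"
  have cells_le: "(\<Sum>k<N. measure \<mu> (A k)) \<le> mass \<mu>" if \<mu>: "\<mu> \<in> finite_borel_measures" for \<mu>
    using sum_measure_Int_disjoint_le[OF \<mu> A, of UNIV] by (simp add: mass_finite_borel_measures[OF \<mu>])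
  note M1 = cells_le[OF \<mu>1, folded m1_def] and M2 = cells_le[OF \<mu>2, folded m2_def]
  consider (plan) \<pi> where "\<And>j k. j \<in> {..<N} \<Longrightarrow> k \<in> {..<N} \<Longrightarrow> 0 \<le> \<pi> j k"
      "\<And>j. j \<in> {..<N} \<Longrightarrow> (\<Sum>k<N. \<pi> j k) \<le> m1 j" "\<And>k. k \<in> {..<N} \<Longrightarrow> (\<Sum>j<N. \<pi> j k) \<le> m2 k"
      "\<gamma> \<le> (\<Sum>j<N. \<Sum>k<N. (2 * a - b * d j k) * \<pi> j k)"
    | (prices) u v where "\<And>j. 0 \<le> u j" "\<And>k. 0 \<le> v k"
      "\<And>j k. j \<in> {..<N} \<Longrightarrow> k \<in> {..<N} \<Longrightarrow> 2 * a - b * d j k \<le> u j + v k"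
      "(\<Sum>j<N. u j * m1 j) + (\<Sum>k<N. v k * m2 k) < \<gamma>"
  proof (rule partial_transport_alternative[of "{..<N}" "{..<N}" m1 m2 \<gamma> "\<lambda>j k. 2 * a - b * d j k"], goal_cases)
    case (5 \<pi>)
    from 5(3-) show ?case by (rule plan)
  next
    case (6 u v)
    from 6(3-) show ?case by (rule prices)
  qed (simp_all add: m1_def m2_def)
  then show "gen_wasserstein a b 1 \<mu>1 \<mu>2 \<le> D + \<epsilon> * (4 * a + b * ?M + 2 * b * mass \<mu>1)"
  proof cases
    case plan
    obtain \<Gamma> where \<Gamma>: "\<Gamma> \<in> finite_borel_measures"
      "\<And>B. B \<in> sets borel \<Longrightarrow> measure \<Gamma> (B \<times> UNIV) \<le> measure \<mu>1 B"
      "\<And>B. B \<in> sets borel \<Longrightarrow> measure \<Gamma> (UNIV \<times> B) \<le> measure \<mu>2 B"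
      "mass \<Gamma> = (\<Sum>j<N. \<Sum>k<N. \<pi> j k)"
      and cost: "\<And>f F. f \<in> borel_measurable borel \<Longrightarrow> (\<And>j k. 0 \<le> F j k) \<Longrightarrow>
        (\<And>j k y z. y \<in> A j \<Longrightarrow> z \<in> A k \<Longrightarrow> f (y, z) \<le> F j k) \<Longrightarrow>
        (\<integral>\<^sup>+z. ennreal (f z) \<partial>\<Gamma>) \<le> ennreal (\<Sum>j<N. \<Sum>k<N. \<pi> j k * F j k)"
    proof (rule cellwise_coupling[OF \<mu>1 \<mu>2 A, of N \<pi>], goal_cases)
      case (4 \<Gamma>)
      from 4(2-) show ?case by (rule that)
    qed (use plan(1-3) in \<open>simp_all add: m1_def m2_def\<close>)
    define T where "T = (\<Sum>j<N. \<Sum>k<N. \<pi> j k)"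
    \<comment> \<open>Replacing points by the centres of their cells changes distances by at most \<open>2 \<epsilon>\<close>.\<close>
    define C where "C = (\<Sum>j<N. \<Sum>k<N. \<pi> j k * (d j k + 2 * \<epsilon>))"
    have C_nonneg: "0 \<le> C" using plan(1) \<epsilon> by (auto simp: C_def d_def intro!: sum_nonneg)
    have C_cost: "(\<integral>\<^sup>+z. ennreal (dist (fst z) (snd z)) \<partial>\<Gamma>) \<le> ennreal C"
      unfolding C_def
    proof (rule cost[OF borel_measurable_dist_pair])
      show "0 \<le> d j k + 2 * \<epsilon>" for j k using \<epsilon> by (simp add: d_def)
      fix j k y z assume "y \<in> A j" "z \<in> A k"
      then have "dist y (x j) < \<epsilon>" "dist z (x k) < \<epsilon>" by (simp_all add: diam)
      moreover have "dist y z \<le> dist y (x j) + (dist (x j) (x k) + dist z (x k))"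
        using dist_triangle[of y z "x j"] dist_triangle[of "x j" z "x k"] dist_commute[of z "x k"] by linarith
      ultimately show "dist (fst (y, z)) (snd (y, z)) \<le> d j k + 2 * \<epsilon>" by (simp add: d_def)
    qed
    have moment1: "(\<integral>\<^sup>+z. ennreal (dist (fst z) (x 0)) \<partial>\<Gamma>) < \<infinity>"
    proof (rule le_less_trans)
      show "(\<integral>\<^sup>+z. ennreal (dist (fst z) (x 0)) \<partial>\<Gamma>) \<le> ennreal (\<Sum>j<N. \<Sum>k<N. \<pi> j k * (\<epsilon> + d j 0))"
      proof (rule cost)
        show "(\<lambda>z::'a\<times>'a. dist (fst z) (x 0)) \<in> borel_measurable borel"
          by (intro borel_measurable_continuous_onI continuous_intros)
        show "0 \<le> \<epsilon> + d j 0" for j using \<epsilon> by (simp add: d_def)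
        show "dist (fst (y, z)) (x 0) \<le> \<epsilon> + d j 0" if "y \<in> A j" for j y z
          using diam[OF that] dist_triangle[of y "x 0" "x j"] by (simp add: d_def)
      qed
    qed simp
    have moment2: "(\<integral>\<^sup>+z. ennreal (dist (snd z) (x 0)) \<partial>\<Gamma>) < \<infinity>"
    proof (rule le_less_trans)
      show "(\<integral>\<^sup>+z. ennreal (dist (snd z) (x 0)) \<partial>\<Gamma>) \<le> ennreal (\<Sum>j<N. \<Sum>k<N. \<pi> j k * (\<epsilon> + d k 0))"
      proof (rule cost)
        show "(\<lambda>z::'a\<times>'a. dist (snd z) (x 0)) \<in> borel_measurable borel"
          by (intro borel_measurable_continuous_onI continuous_intros)
        show "0 \<le> \<epsilon> + d k 0" for k using \<epsilon> by (simp add: d_def)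
        show "dist (snd (y, z)) (x 0) \<le> \<epsilon> + d k 0" if "z \<in> A k" for k y z
          using diam[OF that] dist_triangle[of z "x 0" "x k"] by (simp add: d_def)
      qed
    qed simp
    have GW: "gen_wasserstein a b 1 \<mu>1 \<mu>2 \<le> a * (?M - 2 * T) + b * C"
      unfolding T_def \<Gamma>(4)[symmetric]
      by (rule gen_wasserstein_le_partial_coupling[OF _ _ \<mu>1 \<mu>2 \<Gamma>(1-3) moment1 moment2 C_cost C_nonneg])
        (use a b in simp_all)
    define E where "E = (\<Sum>j<N. \<Sum>k<N. \<pi> j k * d j k)"
    have "(\<Sum>j<N. \<Sum>k<N. (2 * a - b * d j k) * \<pi> j k) = 2 * a * T - b * E"
    proof -
      have "(2 * a - b * d j k) * \<pi> j k = 2 * a * \<pi> j k - b * (\<pi> j k * d j k)" for j k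
        by (simp add: algebra_simps)
      then show ?thesis unfolding T_def E_def by (simp only: sum_subtractf sum_distrib_left)
    qed
    with plan(4) have \<gamma>_le: "\<gamma> \<le> 2 * a * T - b * E" by simp
    have "C = E + T * (2 * \<epsilon>)"
      unfolding C_def T_def E_def by (simp only: distrib_left sum.distrib sum_distrib_right)
    then have bC: "b * C = b * E + 2 * b * \<epsilon> * T" by (simp add: distrib_left)
    have "T \<le> mass \<mu>1"
    proof -
      have "T \<le> (\<Sum>j<N. m1 j)" unfolding T_def using plan(2) by (intro sum_mono) simp
      with M1 show ?thesis by simp
    qed
    then have T_le: "2 * b * \<epsilon> * T \<le> 2 * b * \<epsilon> * mass \<mu>1"
      using b \<epsilon> by (intro mult_left_mono) auto
    have "a * (?M - 2 * T) + b * C \<le> a * ?M - \<gamma> + 2 * b * \<epsilon> * mass \<mu>1"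
      using \<gamma>_le bC T_le by (simp add: right_diff_distrib)
    also have "\<dots> = D + \<epsilon> * (4 * a + b * ?M + 2 * b * mass \<mu>1)"
      unfolding \<gamma>_def by (simp add: algebra_simps)
    finally show ?thesis using GW by simp
  next
    case prices
    obtain f where f: "\<And>y. \<bar>f y\<bar> \<le> a" "\<And>y z. f y - f z \<le> b * dist y z"
      "\<And>j. j < N \<Longrightarrow> a - u j \<le> f (x j)" "\<And>k. k < N \<Longrightarrow> f (x k) \<le> - (a - v k)"
    proof (rule lipschitz_potential_extension[of a b N "\<lambda>j. a - u j" "\<lambda>k. a - v k" x])
      show "a - u j + (a - v k) \<le> b * dist (x j) (x k)" if "j < N" "k < N" for j k
        using prices(3)[of j k] that by (simp add: d_def)
    qed (use a b prices(1,2) in \<open>auto intro: that\<close>)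
    have f_meas: "f \<in> borel_measurable borel"
      using b by (intro borel_measurable_continuous_onI one_sided_lipschitz_continuous[OF _ f(2)]) simp
    have close: "f y \<le> f (x k) + b * \<epsilon>" "f (x k) - b * \<epsilon> \<le> f y" if "y \<in> A k" for y k
    proof -
      have "b * dist y (x k) \<le> b * \<epsilon>" using diam[OF that] b by (intro mult_left_mono) auto
      then show "f y \<le> f (x k) + b * \<epsilon>" "f (x k) - b * \<epsilon> \<le> f y"
        using f(2)[of y "x k"] f(2)[of "x k" y] by (simp_all add: dist_commute)
    qed
    have lower1: "(\<Sum>k<N. (a - u k - b * \<epsilon>) * m1 k) - a * (mass \<mu>1 - (\<Sum>k<N. m1 k)) \<le> (\<integral>y. f y \<partial>\<mu>1)"
      unfolding m1_def using f(3) close(2)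
      by (intro integral_ge_cellwise[OF \<mu>1 A f_meas f(1)]) (force intro: order_trans)
    have lower2: "(\<Sum>k<N. (a - v k - b * \<epsilon>) * m2 k) - a * (mass \<mu>2 - (\<Sum>k<N. m2 k)) \<le> (\<integral>y. - f y \<partial>\<mu>2)"
      unfolding m2_def
    proof (rule integral_ge_cellwise[OF \<mu>2 A])
      show "(\<lambda>y. - f y) \<in> borel_measurable borel" using f_meas by simp
      show "\<bar>- f y\<bar> \<le> a" for y using f(1) by simp
      show "a - v k - b * \<epsilon> \<le> - f y" if "k < N" "y \<in> A k" for k y
        using f(4)[OF that(1)] close(1)[OF that(2)] by linarith
    qed
    have expand: "a * M - 2 * a * \<epsilon> - b * \<epsilon> * M - (\<Sum>k<N. w k * m k)
        \<le> (\<Sum>k<N. (a - w k - b * \<epsilon>) * m k) - a * (M - (\<Sum>k<N. m k))"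
      if "(\<Sum>k<N. m k) \<le> M" "M - \<epsilon> < (\<Sum>k<N. m k)" for w m :: "nat \<Rightarrow> real" and M
    proof -
      define s where "s = (\<Sum>k<N. m k)"
      define t where "t = (\<Sum>k<N. w k * m k)"
      have "(\<Sum>k<N. (a - w k - b * \<epsilon>) * m k) = a * s - t - b * \<epsilon> * s"
        by (simp only: s_def t_def left_diff_distrib sum_subtractf sum_distrib_left)
      moreover have "b * \<epsilon> * s \<le> b * \<epsilon> * M" using that b \<epsilon> by (intro mult_left_mono) (auto simp: s_def)
      moreover have "a * (M - \<epsilon>) \<le> a * s" using that a by (intro mult_left_mono) (auto simp: s_def)
      moreover have "a * (M - \<epsilon>) = a * M - a * \<epsilon>" "a * (M - s) = a * M - a * s"
        by (simp_all add: right_diff_distrib)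
      ultimately show ?thesis unfolding s_def[symmetric] t_def[symmetric] by linarith
    qed
    have "a * mass \<mu>1 - 2 * a * \<epsilon> - b * \<epsilon> * mass \<mu>1 - (\<Sum>k<N. u k * m1 k) \<le> (\<integral>y. f y \<partial>\<mu>1)"
      using expand[OF M1 rest(1)[folded m1_def]] lower1 by (rule order_trans)
    moreover have "a * mass \<mu>2 - 2 * a * \<epsilon> - b * \<epsilon> * mass \<mu>2 - (\<Sum>k<N. v k * m2 k) \<le> (\<integral>y. - f y \<partial>\<mu>2)"
      using expand[OF M2 rest(2)[folded m2_def]] lower2 by (rule order_trans)
    ultimately have "(a * mass \<mu>1 - 2 * a * \<epsilon> - b * \<epsilon> * mass \<mu>1 - (\<Sum>k<N. u k * m1 k))
        + (a * mass \<mu>2 - 2 * a * \<epsilon> - b * \<epsilon> * mass \<mu>2 - (\<Sum>k<N. v k * m2 k)) \<le> D"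
      using dual[OF f(1,2)] by (rule order_trans[OF add_mono])
    with prices(4) have False unfolding \<gamma>_def by (simp add: algebra_simps)
    then show ?thesis ..
  qed
qed

text \<open>The function of \<open>s\<close> is piecewise linear with its only kink at \<open>1\<close> and, as
  \<open>t \<ge> - a\<close>, does not decrease beyond it. So the infimum is attained at \<open>s = 0\<close> or
  \<open>s = 1\<close>.\<close>

lemma dual_entropy_eq_min:
  assumes "0 \<le> a" "- a \<le> t"
  shows "dual_entropy a t = ereal (min t a)"
  unfolding dual_entropy_def
proof (rule antisym)
  have "(INF s\<in>{0..}. ereal (s * t + a * \<bar>1 - s\<bar>)) \<le> ereal (1 * t + a * \<bar>1 - 1\<bar>)"
    by (rule INF_lower) simp
  moreover have "(INF s\<in>{0..}. ereal (s * t + a * \<bar>1 - s\<bar>)) \<le> ereal (0 * t + a * \<bar>1 - 0\<bar>)"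
    by (rule INF_lower) simp
  ultimately show "(INF s\<in>{0..}. ereal (s * t + a * \<bar>1 - s\<bar>)) \<le> ereal (min t a)"
    by (simp add: min_def)
  show "ereal (min t a) \<le> (INF s\<in>{0..}. ereal (s * t + a * \<bar>1 - s\<bar>))"
  proof (rule INF_greatest)
    fix s :: real assume "s \<in> {0..}"
    then have s: "0 \<le> s" by simp
    have "min t a \<le> s * t + a * \<bar>1 - s\<bar>"
    proof (cases "s \<le> 1")
      case True
      have "min t a = s * min t a + (1 - s) * min t a" by (simp add: algebra_simps)
      also have "\<dots> \<le> s * t + (1 - s) * a"
        using s True by (intro add_mono mult_left_mono) auto
      finally show ?thesis using True by (simp add: mult.commute)
    next
      case False
      then have "0 \<le> (s - 1) * (t + a)" using assms by simp
      with False show ?thesis by (simp add: algebra_simps)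
    qed
    then show "ereal (min t a) \<le> ereal (s * t + a * \<bar>1 - s\<bar>)" by (simp del: ereal_min)
  qed
qed

theorem theorem1p1:
  fixes \<mu>1 \<mu>2 :: "'a::polish_space measure" and a b :: real
  assumes "a > 0" and "b > 0"
    and "\<mu>1 \<in> finite_borel_measures" and "\<mu>2 \<in> finite_borel_measures"
  shows "ereal (gen_wasserstein a b 1 \<mu>1 \<mu>2) =
    (SUP (\<phi>1, \<phi>2) \<in> dual_potentials a b.
       ereal ((\<integral>x. real_of_ereal (dual_entropy a (\<phi>1 x)) \<partial>\<mu>1)
            + (\<integral>x. real_of_ereal (dual_entropy a (\<phi>2 x)) \<partial>\<mu>2)))"
    (is "_ = (SUP (\<phi>1, \<phi>2) \<in> _. ereal (?J \<phi>1 \<phi>2))")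
proof -
  have J: "?J \<phi>1 \<phi>2 = (\<integral>x. min (\<phi>1 x) a \<partial>\<mu>1) + (\<integral>x. min (\<phi>2 x) a \<partial>\<mu>2)"
    if "(\<phi>1, \<phi>2) \<in> dual_potentials a b" for \<phi>1 \<phi>2
    using that assms(1) by (simp add: dual_potentials_def dual_entropy_eq_min del: ereal_min)
  define S where "S = (SUP (\<phi>1, \<phi>2) \<in> dual_potentials a b. ereal (?J \<phi>1 \<phi>2))"
  have upper: "ereal (?J \<phi>1 \<phi>2) \<le> S" if "(\<phi>1, \<phi>2) \<in> dual_potentials a b" for \<phi>1 \<phi>2
    unfolding S_def using that by (rule SUP_upper2) simp
  have "S \<le> ereal (gen_wasserstein a b 1 \<mu>1 \<mu>2)"
    unfolding S_def
  proof (rule SUP_least)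
    fix z :: "('a \<Rightarrow> real) \<times> ('a \<Rightarrow> real)" assume "z \<in> dual_potentials a b"
    then obtain \<phi>1 \<phi>2 where z: "z = (\<phi>1, \<phi>2)" and \<phi>: "(\<phi>1, \<phi>2) \<in> dual_potentials a b"
      by (cases z) simp
    then have cont: "continuous_on UNIV \<phi>1" "continuous_on UNIV \<phi>2"
      and lower: "\<And>x. - a \<le> \<phi>1 x" "\<And>x. - a \<le> \<phi>2 x" and sum: "\<And>x y. \<phi>1 x + \<phi>2 y \<le> b * dist x y"
      by (auto simp: dual_potentials_def bcontfun_def)
    have "(\<integral>x. min (\<phi>1 x) a \<partial>\<mu>1) + (\<integral>x. min (\<phi>2 x) a \<partial>\<mu>2) \<le> gen_wasserstein a b 1 \<mu>1 \<mu>2"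
    proof (rule gen_wasserstein_ge_dual)
      show "(\<lambda>x. min (\<phi>1 x) a) \<in> borel_measurable borel" "(\<lambda>x. min (\<phi>2 x) a) \<in> borel_measurable borel"
        using cont by (intro borel_measurable_continuous_onI continuous_intros; simp)+
      show "min (\<phi>1 x) a + min (\<phi>2 y) a \<le> b * dist x y" for x y
        using sum[of x y] by linarith
      show "\<bar>min (\<phi>1 x) a\<bar> \<le> a" "\<bar>min (\<phi>2 x) a\<bar> \<le> a" for x
        using lower(1)[of x] lower(2)[of x] assms(1) by linarith+
    qed (use assms in auto)
    then show "(case z of (\<phi>1, \<phi>2) \<Rightarrow> ereal (?J \<phi>1 \<phi>2)) \<le> ereal (gen_wasserstein a b 1 \<mu>1 \<mu>2)"
      by (simp add: z J[OF \<phi>])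
  qed
  moreover have "ereal (gen_wasserstein a b 1 \<mu>1 \<mu>2) \<le> S"
  proof -
    \<comment> \<open>Truncation at \<open>a\<close> does nothing to a pair \<open>(f, - f)\<close> with \<open>\<bar>f\<bar> \<le> a\<close>, so its dual value is \<open>\<integral> f d(\<mu>1 - \<mu>2)\<close>.\<close>
    have lip: "ereal ((\<integral>y. f y \<partial>\<mu>1) + (\<integral>y. - f y \<partial>\<mu>2)) \<le> S"
      if f: "\<And>y. \<bar>f y\<bar> \<le> a" "\<And>y z. f y - f z \<le> b * dist y z" for f :: "'a \<Rightarrow> real"
    proof -
      have "continuous_on UNIV f"
        using assms(2) by (intro one_sided_lipschitz_continuous[OF _ f(2)]) simp
      moreover have "bounded (range f)" "bounded (range (\<lambda>y. - f y))"
        using f(1) by (auto simp: bounded_iff)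
      moreover have "- a \<le> f y" "- a \<le> - f y" for y
        using f(1)[of y] by linarith+
      ultimately have pot: "(f, \<lambda>y. - f y) \<in> dual_potentials a b"
        using f(2) by (auto simp: dual_potentials_def bcontfun_def intro: continuous_on_minus)
      have "min (f y) a = f y" "min (- f y) a = - f y" for y
        using f(1)[of y] by linarith+
      then show ?thesis using upper[OF pot] J[OF pot] by simp
    qed
    have "ereal 0 \<le> S" using lip[of "\<lambda>_. 0"] assms by simp
    with \<open>S \<le> _\<close> obtain D where D: "S = ereal D" by (cases S) auto
    have "gen_wasserstein a b 1 \<mu>1 \<mu>2 \<le> D"
      using gen_wasserstein_le_lipschitz_bound[OF assms, of D] lip by (simp add: D)
    then show ?thesis by (simp add: D)
  qed
  ultimately show ?thesis unfolding S_def[symmetric] by (rule antisym[rotated])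
qed

end
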